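(* Every finite-dimensional irreducible representation of $U_qL\mathfrak g$ (of type $\mathbf 1$) remains irreducible under restriction to $\hat U^+$.
   Context: $\mathfrak g$ is a finite-dimensional complex simple Lie algebra with vertex set $I$, $\hat I=\{0\}\cup I$ the vertex set of the untwisted affine Dynkin diagram with extended Cartan matrix $(a_{ij})_{i,j\in\hat I}$, symmetrizers $d_i$, $q_i=q^{d_i}$, $\mathbb F=\overline{\mathbb C(q)}$, $\delta=\sum_ia_i\alpha_i$ ($a_0=1$). The quantum loop algebra $U_qL\mathfrak g$ is the $\mathbb F$-algebra generated by $E_i,F_i,K_i^{\pm1}$ ($i\in\hat I$) with relations $K_iK_i^{-1}=1$, $K_iK_j=K_jK_i$, $K_iE_jK_i^{-1}=q_i^{a_{ij}}E_j$, $K_iF_jK_i^{-1}=q_i^{-a_{ij}}F_j$, $[E_i,F_j]=\delta_{ij}(K_i-K_i^{-1})/(q_i-q_i^{-1})$, quantum Serre relations, and $\prod_iK_i^{a_i}=1$. A finite-dimensional representation is of type $\mathbf 1$ if the $K_i$ act semisimply with eigenvalues in $q^{\mathbb Z}$. $\hat U^+$ is the subalgebra generated by all $E_i$, $i\in\hat I$. *)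

theory Defs
  imports "HOL-Algebra.Algebraic_Closure_Type" "HOL-Computational_Algebra.Fraction_Field"
    "Jordan_Normal_Form.Matrix"
begin

text \<open>Vertex set I = {1..l} of the finite Dynkin diagram; the affine vertex set is {0..l}.
  Generalized Cartan matrices are functions nat => nat => int, symmetrizers nat => nat.\<close>

definition fin_type_cartan :: "(nat \<Rightarrow> nat \<Rightarrow> int) \<Rightarrow> (nat \<Rightarrow> nat) \<Rightarrow> nat \<Rightarrow> bool" where
  "fin_type_cartan A d l \<longleftrightarrow>
     l \<ge> 1 \<and>
     (\<forall>i\<in>{1..l}. A i i = 2) \<and>
     (\<forall>i\<in>{1..l}. \<forall>j\<in>{1..l}. i \<noteq> j \<longrightarrow> A i j \<le> 0) \<and>
     (\<forall>i\<in>{1..l}. d i > 0) \<and>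
     (\<exists>i\<in>{1..l}. d i = 1) \<and>
     (\<forall>i\<in>{1..l}. \<forall>j\<in>{1..l}. int (d i) * A i j = int (d j) * A j i) \<and>
     (\<forall>x :: nat \<Rightarrow> real. (\<exists>i\<in>{1..l}. x i \<noteq> 0) \<longrightarrow>
        (\<Sum>i\<in>{1..l}. \<Sum>j\<in>{1..l}. x i * real (d i) * real_of_int (A i j) * x j) > 0) \<and>
     (\<forall>J. J \<subseteq> {1..l} \<and> J \<noteq> {} \<and> J \<noteq> {1..l} \<longrightarrow>
        (\<exists>i\<in>J. \<exists>j\<in>{1..l} - J. A i j \<noteq> 0))"

definition simple_root :: "nat \<Rightarrow> nat \<Rightarrow> int" where
  "simple_root i = (\<lambda>j. if j = i then 1 else 0)"

definition coroot_pair :: "(nat \<Rightarrow> nat \<Rightarrow> int) \<Rightarrow> nat \<Rightarrow> nat \<Rightarrow> (nat \<Rightarrow> int) \<Rightarrow> int" where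
  "coroot_pair A l i \<beta> = (\<Sum>j\<in>{1..l}. A i j * \<beta> j)"

definition simple_refl :: "(nat \<Rightarrow> nat \<Rightarrow> int) \<Rightarrow> nat \<Rightarrow> nat \<Rightarrow> (nat \<Rightarrow> int) \<Rightarrow> (nat \<Rightarrow> int)" where
  "simple_refl A l i \<beta> = (\<lambda>j. \<beta> j - (if j = i then coroot_pair A l i \<beta> else 0))"

inductive_set roots :: "(nat \<Rightarrow> nat \<Rightarrow> int) \<Rightarrow> nat \<Rightarrow> (nat \<Rightarrow> int) set"
  for A l where
  simple: "i \<in> {1..l} \<Longrightarrow> simple_root i \<in> roots A l"
| refl: "\<beta> \<in> roots A l \<Longrightarrow> i \<in> {1..l} \<Longrightarrow> simple_refl A l i \<beta> \<in> roots A l"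

definition highest_root :: "(nat \<Rightarrow> nat \<Rightarrow> int) \<Rightarrow> nat \<Rightarrow> (nat \<Rightarrow> int) \<Rightarrow> bool" where
  "highest_root A l \<theta> \<longleftrightarrow> \<theta> \<in> roots A l \<and> (\<forall>\<beta>\<in>roots A l. \<forall>i\<in>{1..l}. \<beta> i \<le> \<theta> i)"

text \<open>Untwisted affine extension: row/column 0 of the extended Cartan matrix and d_0 are
  determined by the highest root theta (alpha_0 = delta - theta).\<close>
definition untwisted_affine_datum ::
  "(nat \<Rightarrow> nat \<Rightarrow> int) \<Rightarrow> (nat \<Rightarrow> nat) \<Rightarrow> nat \<Rightarrow> (nat \<Rightarrow> int) \<Rightarrow> bool" where
  "untwisted_affine_datum A d l \<theta> \<longleftrightarrow>
     fin_type_cartan A d l \<and> highest_root A l \<theta> \<and>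
     A 0 0 = 2 \<and>
     (\<forall>j\<in>{1..l}. A j 0 = - coroot_pair A l j \<theta>) \<and>
     2 * int (d 0) = (\<Sum>i\<in>{1..l}. \<Sum>j\<in>{1..l}. \<theta> i * int (d i) * A i j * \<theta> j) \<and>
     (\<forall>j\<in>{1..l}. int (d 0) * A 0 j = - (\<Sum>i\<in>{1..l}. \<theta> i * int (d i) * A i j))"

text \<open>Marks a_i of delta = sum a_i alpha_i, with a_0 = 1.\<close>
definition mark :: "(nat \<Rightarrow> int) \<Rightarrow> nat \<Rightarrow> nat" where
  "mark \<theta> i = (if i = 0 then 1 else nat (\<theta> i))"

type_synonym F = "complex poly fract alg_closure"

definition qq :: F where
  "qq = to_ac (Fract [:0, 1:] 1)"

definition qint :: "F \<Rightarrow> nat \<Rightarrow> F" where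
  "qint x m = (x powi int m - x powi (- int m)) / (x - inverse x)"

definition qfact :: "F \<Rightarrow> nat \<Rightarrow> F" where
  "qfact x m = (\<Prod>k\<in>{1..m}. qint x k)"

definition qbinom :: "F \<Rightarrow> nat \<Rightarrow> nat \<Rightarrow> F" where
  "qbinom x m r = qfact x m / (qfact x r * qfact x (m - r))"

definition msum :: "nat \<Rightarrow> (nat \<Rightarrow> F mat) \<Rightarrow> nat list \<Rightarrow> F mat" where
  "msum n f xs = foldr (\<lambda>r M. f r + M) xs (0\<^sub>m n n)"

definition mprod :: "nat \<Rightarrow> (nat \<Rightarrow> F mat) \<Rightarrow> nat list \<Rightarrow> F mat" where
  "mprod n f xs = foldr (\<lambda>r M. f r * M) xs (1\<^sub>m n)"

definition is_rep_UqLg ::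
  "(nat \<Rightarrow> nat \<Rightarrow> int) \<Rightarrow> (nat \<Rightarrow> nat) \<Rightarrow> nat \<Rightarrow> (nat \<Rightarrow> int) \<Rightarrow> nat \<Rightarrow>
   (nat \<Rightarrow> F mat) \<Rightarrow> (nat \<Rightarrow> F mat) \<Rightarrow> (nat \<Rightarrow> F mat) \<Rightarrow> (nat \<Rightarrow> F mat) \<Rightarrow> bool" where
  "is_rep_UqLg A d l \<theta> n E Fm K Kinv \<longleftrightarrow>
     (\<forall>i\<in>{0..l}. E i \<in> carrier_mat n n \<and> Fm i \<in> carrier_mat n n \<and>
                 K i \<in> carrier_mat n n \<and> Kinv i \<in> carrier_mat n n) \<and>
     (\<forall>i\<in>{0..l}. K i * Kinv i = 1\<^sub>m n \<and> Kinv i * K i = 1\<^sub>m n) \<and>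
     (\<forall>i\<in>{0..l}. \<forall>j\<in>{0..l}. K i * K j = K j * K i) \<and>
     (\<forall>i\<in>{0..l}. \<forall>j\<in>{0..l}. K i * E j * Kinv i = ((qq ^ d i) powi A i j) \<cdot>\<^sub>m E j) \<and>
     (\<forall>i\<in>{0..l}. \<forall>j\<in>{0..l}. K i * Fm j * Kinv i = ((qq ^ d i) powi (- A i j)) \<cdot>\<^sub>m Fm j) \<and>
     (\<forall>i\<in>{0..l}. \<forall>j\<in>{0..l}. E i * Fm j - Fm j * E i =
        (if i = j then (1 / (qq ^ d i - inverse (qq ^ d i))) \<cdot>\<^sub>m (K i - Kinv i) else 0\<^sub>m n n)) \<and>
     (\<forall>i\<in>{0..l}. \<forall>j\<in>{0..l}. i \<noteq> j \<longrightarrow>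
        (let m = nat (1 - A i j) in
          msum n (\<lambda>r. ((-1) ^ r * qbinom (qq ^ d i) m r) \<cdot>\<^sub>m
                        (E i ^\<^sub>m (m - r) * E j * E i ^\<^sub>m r)) [0..<Suc m] = 0\<^sub>m n n \<and>
          msum n (\<lambda>r. ((-1) ^ r * qbinom (qq ^ d i) m r) \<cdot>\<^sub>m
                        (Fm i ^\<^sub>m (m - r) * Fm j * Fm i ^\<^sub>m r)) [0..<Suc m] = 0\<^sub>m n n)) \<and>
     mprod n (\<lambda>i. K i ^\<^sub>m mark \<theta> i) [0..<Suc l] = 1\<^sub>m n"

definition type_one :: "nat \<Rightarrow> nat \<Rightarrow> (nat \<Rightarrow> F mat) \<Rightarrow> bool" where
  "type_one l n K \<longleftrightarrow>
     (\<forall>i\<in>{0..l}. \<exists>D. similar_mat (K i) D \<and> diagonal_mat D \<and>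
        (\<forall>k<n. \<exists>m::int. D $$ (k, k) = qq powi m))"

definition subspace_vec :: "nat \<Rightarrow> F vec set \<Rightarrow> bool" where
  "subspace_vec n W \<longleftrightarrow> W \<subseteq> carrier_vec n \<and> 0\<^sub>v n \<in> W \<and>
     (\<forall>v\<in>W. \<forall>w\<in>W. v + w \<in> W) \<and> (\<forall>c. \<forall>v\<in>W. c \<cdot>\<^sub>v v \<in> W)"

text \<open>F^n is an irreducible module for the algebra generated by the operators in Ops.\<close>
definition irreducible_under :: "nat \<Rightarrow> F mat set \<Rightarrow> bool" where
  "irreducible_under n Ops \<longleftrightarrow> n > 0 \<and>
     (\<forall>W. subspace_vec n W \<and> (\<forall>M\<in>Ops. \<forall>w\<in>W. M *\<^sub>v w \<in> W) \<longrightarrow>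
          W = {0\<^sub>v n} \<or> W = carrier_vec n)"

end

theory Submission
  imports Defs "HOL-Library.Function_Algebras"
begin

text \<open>Let \<open>W\<close> be a nonzero proper subspace stable under all \<open>E\<^sub>i\<close>. Replacing \<open>W\<close> by its associated
  graded space for the \<open>K\<^sub>i\<close>-weight filtrations, one \<open>i\<close> at a time, we may assume that \<open>W\<close> is also
  stable under all \<open>K\<^sub>i\<close>. For every \<open>i\<close>, quantum \<open>sl\<^sub>2\<close>-theory makes powers of \<open>E\<^sub>i\<close> inject the part of
  \<open>W\<close> of \<open>K\<^sub>i\<close>-weight \<open>-m\<close> into the part of weight \<open>m\<close> (\<open>m \<ge> 0\<close>), so the sum of the \<open>K\<^sub>i\<close>-weights of
  \<open>W\<close> is nonnegative. As \<open>\<Prod> K\<^sub>i\<close> to the powers \<open>a\<^sub>i > 0\<close> is the identity, a positive combination of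
  these sums vanishes, so each of them does and all these injections are bijections. This hard Lefschetz
  property forces \<open>W\<close> to be stable under all \<open>F\<^sub>i\<close>, contradicting irreducibility.\<close>

subsection \<open>Weight spaces and associated graded spaces\<close>

text \<open>\<open>M\<close> may contain exponents that do not occur as weights. Diagonalisability
  is stated as a spanning property, so that identities between linear maps can be checked on weight
  vectors alone.\<close>

locale weight_operator = vector_space scale
  for scale :: "'a::field \<Rightarrow> 'v::ab_group_add \<Rightarrow> 'v" (infixr \<open>*s\<close> 75) +
  fixes q :: 'a and K :: "'v \<Rightarrow> 'v" and M :: "int set"
  assumes linear_K: "Vector_Spaces.linear scale scale K"
    and q_nonzero: "q \<noteq> 0"
    and q_not_root_of_unity: "q powi k = 1 \<Longrightarrow> k = 0"
    and finite_M: "finite M"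
    and span_weight_vectors: "span (\<Union>m\<in>M. {x. K x = (q powi m) *s x}) = UNIV"
begin

sublocale self: vector_space_pair scale scale
  by unfold_locales

definition wt :: "int \<Rightarrow> 'v set" where
  "wt m = {x. K x = (q powi m) *s x}"

lemma powi_eq_iff: "q powi a = q powi b \<longleftrightarrow> a = b"
proof
  assume "q powi a = q powi b"
  then have "q powi (a - b) = 1"
    using q_nonzero by (simp add: power_int_diff)
  then show "a = b"
    using q_not_root_of_unity by force
qed simp

lemma subspace_wt: "subspace (wt m)"
proof (rule subspaceI)
  show "0 \<in> wt m" by (simp add: wt_def self.linear_0[OF linear_K])
  show "x + y \<in> wt m" if "x \<in> wt m" "y \<in> wt m" for x y
    using that by (simp add: wt_def self.linear_add[OF linear_K] scale_right_distrib)
  show "c *s x \<in> wt m" if "x \<in> wt m" for c x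
    using that by (simp add: wt_def self.linear_scale[OF linear_K] mult.commute)
qed

section \<open>Projections onto the weight spaces\<close>

lemma linear_eq_on_wt:
  assumes "Vector_Spaces.linear scale scale f" "Vector_Spaces.linear scale scale g"
    and "\<And>m x. m \<in> M \<Longrightarrow> x \<in> wt m \<Longrightarrow> f x = g x"
  shows "f x = g x"
proof (rule self.linear_eq_on[OF assms(1,2)])
  show "x \<in> span (\<Union>m\<in>M. wt m)"
    using span_weight_vectors by (simp add: wt_def)
qed (use assms(3) in auto)

text \<open>Lagrange interpolation: for \<open>m\<close> in \<open>M\<close> the projection is the
  product of the factors \<open>(K - q powi j) / (q powi m - q powi j)\<close> over \<open>j\<close>
  in \<open>M - {m}\<close>. Being a polynomial in \<open>K\<close>, it maps every
  \<open>K\<close>-stable subspace into itself. For other \<open>m\<close> the zero map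
  serves.\<close>

lemma proj_exists:
  "\<exists>p. Vector_Spaces.linear scale scale p \<and> (\<forall>W. subspace W \<longrightarrow> K ` W \<subseteq> W \<longrightarrow> p ` W \<subseteq> W) \<and>
     (\<forall>k\<in>M. \<forall>x\<in>wt k. p x = (if k = m then x else 0))"
proof (cases "m \<in> M")
  case True
  \<comment> \<open>The factors are multiplied in one at a time, so the claim for \<open>J\<close>
    speaks only of the weights in \<open>J\<close> and of \<open>m\<close>.\<close>
  have "\<exists>p. Vector_Spaces.linear scale scale p \<and> (\<forall>W. subspace W \<longrightarrow> K ` W \<subseteq> W \<longrightarrow> p ` W \<subseteq> W) \<and>
      (\<forall>k\<in>J \<union> {m}. \<forall>x\<in>wt k. p x = (if k = m then x else 0))"
    if "finite J" "m \<notin> J" for J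
    using that
  proof (induction J rule: finite_induct)
    case empty
    have "Vector_Spaces.linear scale scale (\<lambda>x. x)" by (rule linear_ident)
    then show ?case by (intro exI[of _ "\<lambda>x. x"]) auto
  next
    case (insert j J)
    then have "m \<notin> J" by simp
    from insert.IH[OF this] obtain p where p: "Vector_Spaces.linear scale scale p"
        and p2: "\<forall>W. subspace W \<longrightarrow> K ` W \<subseteq> W \<longrightarrow> p ` W \<subseteq> W"
        and p3: "\<forall>k\<in>J \<union> {m}. \<forall>x\<in>wt k. p x = (if k = m then x else 0)"
      by (elim exE conjE)
    define c where "c = inverse (q powi m - q powi j)"
    define p' where "p' x = c *s (p (K x) - (q powi j) *s p x)" for x
    have c: "c * (q powi m - q powi j) = 1"
      using insert.prems powi_eq_iff[of m j] by (simp add: c_def)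
    have "Vector_Spaces.linear scale scale (\<lambda>x. p (K x))"
      using Vector_Spaces.linear_compose[OF linear_K p] by (simp add: comp_def)
    then have "Vector_Spaces.linear scale scale p'"
      unfolding p'_def[abs_def]
      by (intro self.linear_compose_scale_right self.linear_compose_sub p)
    moreover have "p' ` W \<subseteq> W" if W: "subspace W" "K ` W \<subseteq> W" for W
      using p2[rule_format, OF W] W(2) unfolding p'_def
      by (auto intro!: subspace_scale[OF W(1)] subspace_diff[OF W(1)])
    moreover have "p' x = (if k = m then x else 0)" if k: "k \<in> insert j J \<union> {m}" and x: "x \<in> wt k" for k x
    proof -
      have eq: "p' x = (c * (q powi k - q powi j)) *s p x"
        using x p by (simp add: p'_def wt_def self.linear_scale scale_left_diff_distrib
            scale_right_diff_distrib right_diff_distrib)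
      consider "k = m" | "k = j" "k \<noteq> m" | "k \<in> J" "k \<noteq> m" using k by blast
      then show ?thesis
      proof cases
        case 1 then show ?thesis using eq c p3 x by simp
      next
        case 2 then show ?thesis using eq by simp
      next
        case 3 then show ?thesis using eq p3 x by simp
      qed
    qed
    ultimately show ?case by blast
  qed
  from this[of "M - {m}"] show ?thesis
    using finite_M True by (simp add: insert_absorb)
next
  case False
  have "Vector_Spaces.linear scale scale (\<lambda>x. 0)" by (rule self.linear_zero)
  with False show ?thesis
    by (intro exI[of _ "\<lambda>x. 0"]) (auto simp: subspace_0)
qed

definition proj :: "int \<Rightarrow> 'v \<Rightarrow> 'v" where
  "proj m = (SOME p. Vector_Spaces.linear scale scale p \<and>
     (\<forall>W. subspace W \<longrightarrow> K ` W \<subseteq> W \<longrightarrow> p ` W \<subseteq> W) \<and>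
     (\<forall>k\<in>M. \<forall>x\<in>wt k. p x = (if k = m then x else 0)))"

lemma linear_proj: "Vector_Spaces.linear scale scale (proj m)"
  and proj_stable: "subspace W \<Longrightarrow> K ` W \<subseteq> W \<Longrightarrow> x \<in> W \<Longrightarrow> proj m x \<in> W"
  and proj_wt_M: "k \<in> M \<Longrightarrow> x \<in> wt k \<Longrightarrow> proj m x = (if k = m then x else 0)"
proof -
  note spec = someI_ex[OF proj_exists[of m], folded proj_def]
  show "Vector_Spaces.linear scale scale (proj m)"
    using spec by (rule conjunct1)
  show "subspace W \<Longrightarrow> K ` W \<subseteq> W \<Longrightarrow> x \<in> W \<Longrightarrow> proj m x \<in> W"
    using spec[THEN conjunct2, THEN conjunct1, rule_format, of W] by (meson imageI subsetD)
  show "k \<in> M \<Longrightarrow> x \<in> wt k \<Longrightarrow> proj m x = (if k = m then x else 0)"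
    using spec[THEN conjunct2, THEN conjunct2, rule_format] by blast
qed

lemma sum_proj: "(\<Sum>m\<in>M. proj m x) = x"
proof (rule linear_eq_on_wt[where f = "\<lambda>x. \<Sum>m\<in>M. proj m x" and g = "\<lambda>x. x"])
  show "Vector_Spaces.linear scale scale (\<lambda>x. \<Sum>m\<in>M. proj m x)"
    by (rule self.linear_compose_sum) (simp add: linear_proj)
  show "Vector_Spaces.linear scale scale (\<lambda>x. x)" by (rule linear_ident)
qed (simp add: proj_wt_M finite_M)

lemma proj_in_wt: "proj m x \<in> wt m"
proof -
  have "K (proj m x) = (q powi m) *s proj m x"
  proof (rule linear_eq_on_wt[where f = "\<lambda>x. K (proj m x)" and g = "\<lambda>x. (q powi m) *s proj m x"])
    show "Vector_Spaces.linear scale scale (\<lambda>x. K (proj m x))"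
      using Vector_Spaces.linear_compose[OF linear_proj linear_K] by (simp add: comp_def)
    show "Vector_Spaces.linear scale scale (\<lambda>x. (q powi m) *s proj m x)"
      by (rule self.linear_compose_scale_right) (rule linear_proj)
    show "K (proj m x) = (q powi m) *s proj m x" if "k \<in> M" "x \<in> wt k" for k x
      using proj_wt_M[OF that] that linear_K by (auto simp: wt_def self.linear_0)
  qed
  then show ?thesis by (simp add: wt_def)
qed

text \<open>As \<open>proj k\<close> commutes with \<open>K\<close>, applying it to
  \<open>K x = (q powi m) *s x\<close> shows that \<open>q powi m - q powi k\<close> kills
  \<open>proj k x\<close>. This scalar is nonzero for every \<open>k\<close> in \<open>M\<close>,
  and \<open>x\<close> is the sum of these components.\<close>

lemma wt_outside: "x \<in> wt m \<Longrightarrow> m \<notin> M \<Longrightarrow> x = 0"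
proof -
  assume x: "x \<in> wt m" and m: "m \<notin> M"
  have "proj k x = 0" if k: "k \<in> M" for k
  proof -
    have "proj k (K x) = K (proj k x)"
    proof (rule linear_eq_on_wt[where f = "\<lambda>x. proj k (K x)" and g = "\<lambda>x. K (proj k x)"])
      show "Vector_Spaces.linear scale scale (\<lambda>x. K (proj k x))"
        using Vector_Spaces.linear_compose[OF linear_proj linear_K] by (simp add: comp_def)
      show "Vector_Spaces.linear scale scale (\<lambda>x. proj k (K x))"
        using Vector_Spaces.linear_compose[OF linear_K linear_proj] by (simp add: comp_def)
      show "proj k (K y) = K (proj k y)" if "j \<in> M" "y \<in> wt j" for j y
        using proj_wt_M[OF that] that linear_K linear_proj[of k]
        by (auto simp: wt_def self.linear_0 self.linear_scale)
    qed
    then have "(q powi m) *s proj k x = (q powi k) *s proj k x"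
      using x proj_in_wt[of k x] linear_proj[of k] by (simp add: wt_def self.linear_scale)
    moreover have "q powi m \<noteq> q powi k" using m k powi_eq_iff by auto
    ultimately show ?thesis by simp
  qed
  then show "x = 0" using sum_proj[of x] by simp
qed

lemma proj_wt: "x \<in> wt k \<Longrightarrow> proj m x = (if k = m then x else 0)"
  using proj_wt_M[of k x m] wt_outside[of x k] linear_proj[of m]
  by (cases "k \<in> M") (auto simp: self.linear_0)

lemma proj_outside: "m \<notin> M \<Longrightarrow> proj m x = 0"
  using wt_outside proj_in_wt by blast

lemma proj_homogeneous:
  assumes "Vector_Spaces.linear scale scale Y" and Y: "\<And>m x. x \<in> wt m \<Longrightarrow> Y x \<in> wt (m + r)"
  shows "proj m (Y x) = Y (proj (m - r) x)"
proof (rule linear_eq_on_wt[where f = "\<lambda>x. proj m (Y x)" and g = "\<lambda>x. Y (proj (m - r) x)"])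
  show "Vector_Spaces.linear scale scale (\<lambda>x. proj m (Y x))"
    using Vector_Spaces.linear_compose[OF assms(1) linear_proj] by (simp add: comp_def)
  show "Vector_Spaces.linear scale scale (\<lambda>x. Y (proj (m - r) x))"
    using Vector_Spaces.linear_compose[OF linear_proj assms(1)] by (simp add: comp_def)
  show "proj m (Y x) = Y (proj (m - r) x)" if "k \<in> M" "x \<in> wt k" for k x
    using proj_wt[OF Y[OF that(2)], of m] proj_wt[OF that(2), of "m - r"] assms(1)
    by (auto simp: self.linear_0)
qed

text \<open>The projection \<open>proj m\<close> fixes \<open>x\<close> and kills every member of
  \<open>B\<close> of another weight. Hence a basis of weight vectors splits into bases of the
  weight parts.\<close>

lemma proj_span_weight_vectors:
  assumes B: "\<And>b. b \<in> B \<Longrightarrow> b \<in> wt (lam b)" and x: "x \<in> span B" "x \<in> wt m"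
  shows "x \<in> span {b \<in> B. lam b = m}"
proof -
  have "proj m x \<in> span {b \<in> B. lam b = m}"
    using x(1)
  proof (induction rule: span_induct_alt)
    case base
    then show ?case using linear_proj by (simp add: self.linear_0 span_zero)
  next
    case (step c b y)
    have "proj m b \<in> span {b \<in> B. lam b = m}"
      using proj_wt[OF B[OF step(1)], of m] step(1) by (auto simp: span_zero intro: span_base)
    then show ?case using step linear_proj[of m]
      by (simp add: self.linear_add self.linear_scale span_add span_scale)
  qed
  then show ?thesis using proj_wt[OF x(2), of m] by simp
qed

text \<open>The associated graded space of \<open>W\<close> for the filtration by weights at least \<open>m\<close>,
  realised inside the ambient space: the degree \<open>m\<close> part consists of the lowest components.\<close>

definition initial :: "'v set \<Rightarrow> 'v set" where
  "initial W = {x. \<forall>m. \<exists>w\<in>W. (\<forall>j<m. proj j w = 0) \<and> proj m w = proj m x}"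

lemma subspace_initial:
  assumes W: "subspace W"
  shows "subspace (initial W)"
proof -
  note lin = linear_proj
  have "\<exists>w\<in>W. (\<forall>j<m. proj j w = 0) \<and> proj m w = proj m (x + y)"
    if "x \<in> initial W" "y \<in> initial W" for x y m
  proof -
    obtain u v where "u \<in> W" "\<forall>j<m. proj j u = 0" "proj m u = proj m x"
        "v \<in> W" "\<forall>j<m. proj j v = 0" "proj m v = proj m y"
      using \<open>x \<in> initial W\<close> \<open>y \<in> initial W\<close> unfolding initial_def by blast
    then show ?thesis
      by (intro bexI[of _ "u + v"]) (auto simp: self.linear_add[OF lin] subspace_add[OF W])
  qed
  moreover have "\<exists>w\<in>W. (\<forall>j<m. proj j w = 0) \<and> proj m w = proj m (c *s x)"
    if "x \<in> initial W" for c x m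
  proof -
    obtain u where "u \<in> W" "\<forall>j<m. proj j u = 0" "proj m u = proj m x"
      using \<open>x \<in> initial W\<close> unfolding initial_def by blast
    then show ?thesis
      by (intro bexI[of _ "c *s u"]) (auto simp: self.linear_scale[OF lin] subspace_scale[OF W])
  qed
  moreover have "0 \<in> initial W"
    unfolding initial_def using subspace_0[OF W] self.linear_0[OF lin] by auto
  ultimately show ?thesis
    unfolding subspace_def initial_def by auto
qed

text \<open>In degree \<open>m\<close>, the image under \<open>Y\<close> of a witness for degree
  \<open>m - r\<close> serves. Applied to the raising operators, and with \<open>r = 0\<close> to
  commuting operators, this shows that passing to the graded space loses none of the stability
  already obtained.\<close>

lemma initial_homogeneous:
  assumes Y: "Vector_Spaces.linear scale scale Y" "\<And>m x. x \<in> wt m \<Longrightarrow> Y x \<in> wt (m + r)"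
    and W: "Y ` W \<subseteq> W"
  shows "Y ` initial W \<subseteq> initial W"
proof -
  have "\<exists>w\<in>W. (\<forall>j<m. proj j w = 0) \<and> proj m w = proj m (Y x)" if "x \<in> initial W" for x m
  proof -
    obtain u where "u \<in> W" "\<forall>j<m - r. proj j u = 0" "proj (m - r) u = proj (m - r) x"
      using \<open>x \<in> initial W\<close> unfolding initial_def by blast
    then show ?thesis
      using W by (intro bexI[of _ "Y u"]) (auto simp: proj_homogeneous[OF Y] self.linear_0[OF Y(1)])
  qed
  then show ?thesis unfolding initial_def by auto
qed

lemma K_wt: "x \<in> wt m \<Longrightarrow> K x \<in> wt m"
  using subspace_scale[OF subspace_wt] by (simp add: wt_def)

text \<open>This is the gain of grading, as \<open>W\<close> itself need not be
  \<open>K\<close>-stable. In degree \<open>m\<close> the operator is a scalar, so a multiple of the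
  old witness serves.\<close>

lemma initial_K_stable:
  assumes W: "subspace W"
  shows "K ` initial W \<subseteq> initial W"
proof -
  have pK: "proj m (K x) = (q powi m) *s proj m x" for m x
    using proj_homogeneous[OF linear_K, of 0 m x] K_wt proj_in_wt[of m x] by (simp add: wt_def)
  have "\<exists>w\<in>W. (\<forall>j<m. proj j w = 0) \<and> proj m w = proj m (K x)" if "x \<in> initial W" for x m
  proof -
    obtain u where "u \<in> W" "\<forall>j<m. proj j u = 0" "proj m u = proj m x"
      using \<open>x \<in> initial W\<close> unfolding initial_def by blast
    then show ?thesis
      by (intro bexI[of _ "(q powi m) *s u"])
        (auto simp: self.linear_scale[OF linear_proj] subspace_scale[OF W] pK)
  qed
  then show ?thesis unfolding initial_def by auto
qed

text \<open>Each component of a member of \<open>initial W\<close> is also a component of a member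
  of \<open>W\<close>, and the projections preserve \<open>T\<close>.\<close>

lemma initial_subset:
  assumes T: "subspace T" "K ` T \<subseteq> T" "W \<subseteq> T"
  shows "initial W \<subseteq> T"
proof
  fix x assume x: "x \<in> initial W"
  have "proj m x \<in> T" for m
  proof -
    obtain w where "w \<in> W" "proj m w = proj m x"
      using x unfolding initial_def by blast
    then show ?thesis using proj_stable[OF T(1,2), of w m] T(3) by auto
  qed
  then have "(\<Sum>m\<in>M. proj m x) \<in> T" by (intro subspace_sum T(1))
  then show "x \<in> T" by (simp add: sum_proj)
qed

lemma proj_all_zero: "(\<And>m. m \<in> M \<Longrightarrow> proj m x = 0) \<Longrightarrow> x = 0"
  using sum_proj[of x] by simp

text \<open>The lowest nonzero component of a nonzero member of \<open>W\<close> lies in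
  \<open>initial W\<close>.\<close>

lemma initial_zero:
  assumes W: "subspace W" and "initial W = {0}"
  shows "W = {0}"
proof -
  have "w = 0" if w: "w \<in> W" for w
  proof (rule ccontr)
    assume "w \<noteq> 0"
    define S where "S = {m \<in> M. proj m w \<noteq> 0}"
    have S: "finite S" "S \<noteq> {}" using finite_M proj_all_zero[of w] \<open>w \<noteq> 0\<close> by (auto simp: S_def)
    define m where "m = Min S"
    have m: "proj m w \<noteq> 0" using Min_in[OF S] by (simp add: m_def S_def)
    have below: "proj j w = 0" if "j < m" for j
      using Min_le[OF S(1), of j] that proj_outside[of j w] by (auto simp: m_def S_def)
    have "proj m w \<in> initial W"
      unfolding initial_def
    proof (intro CollectI allI)
      fix k
      show "\<exists>u\<in>W. (\<forall>j<k. proj j u = 0) \<and> proj k u = proj k (proj m w)"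
      proof (cases "k = m")
        case True
        then show ?thesis using w below proj_wt[OF proj_in_wt[of m w], of m] by (intro bexI[of _ w]) auto
      next
        case False
        then show ?thesis using subspace_0[OF W] proj_wt[OF proj_in_wt[of m w], of k]
          by (intro bexI[of _ 0]) (auto simp: self.linear_0[OF linear_proj])
      qed
    qed
    then show False using assms(2) m by auto
  qed
  then show ?thesis using subspace_0[OF W] by auto
qed

text \<open>Successive elimination: subtracting a member of \<open>W\<close> with the same lowest
  component pushes \<open>x\<close> into higher degrees, of which there are finitely many.\<close>

lemma initial_full:
  assumes T: "subspace T" "T \<subseteq> initial W" and W: "subspace W" "W \<subseteq> T"
  shows "T \<subseteq> W"
proof -
  \<comment> \<open>Here \<open>b\<close> exceeds all weights, and \<open>k\<close> counts the
    degrees just below \<open>b\<close> in which \<open>x\<close> may still have components.\<close>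
  have step: "x \<in> W" if "x \<in> T" "\<And>j. j \<in> M \<Longrightarrow> j < b - int k \<Longrightarrow> proj j x = 0" "\<And>j. j \<in> M \<Longrightarrow> j < b" for x k b
    using that(1,2)
  proof (induction k arbitrary: x)
    case 0
    have "x = 0"
    proof (rule proj_all_zero)
      show "proj m x = 0" if "m \<in> M" for m
        using 0(2)[OF that] \<open>\<And>j. j \<in> M \<Longrightarrow> j < b\<close>[OF that] by simp
    qed
    then show ?case by (simp add: subspace_0[OF W(1)])
  next
    case (Suc k)
    define m where "m = b - int (Suc k)"
    obtain w where w: "w \<in> W" "\<And>j. j < m \<Longrightarrow> proj j w = 0" "proj m w = proj m x"
      using Suc.prems(1) T(2) unfolding initial_def by blast
    have "x - w \<in> W"
    proof (rule Suc.IH)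
      show "x - w \<in> T" using Suc.prems(1) w(1) W(2) subspace_diff[OF T(1)] by auto
      show "proj j (x - w) = 0" if "j \<in> M" "j < b - int k" for j
      proof (cases "j = m")
        case True then show ?thesis using w(3) by (simp add: self.linear_diff[OF linear_proj])
      next
        case False
        then have "j < m" using that by (simp add: m_def)
        then show ?thesis using w(2) Suc.prems(2)[OF that(1)] by (simp add: self.linear_diff[OF linear_proj] m_def)
      qed
    qed
    then show ?case using subspace_add[OF W(1) _ w(1), of "x - w"] by simp
  qed
  \<comment> \<open>Inserting 0 keeps \<open>Max\<close> and \<open>Min\<close> meaningful if
    \<open>M\<close> is empty.\<close>
  define b where "b = Max (insert 0 M) + 1"
  define c where "c = Min (insert 0 M)"
  have b: "j < b" and c: "c \<le> j" if "j \<in> M" for j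
    using that finite_M by (auto simp: b_def c_def intro!: Max_ge add_le_less_mono)
  show ?thesis
  proof
    fix x assume "x \<in> T"
    then show "x \<in> W"
      by (rule step[of x b "nat (b - c)"]) (use b c in force)+
  qed
qed

text \<open>On weight \<open>m\<close> the map \<open>L\<close> is the scalar
  \<open>inverse (q powi m)\<close>, and the components of a member of \<open>U\<close> stay in
  \<open>U\<close>. Thus stability under \<open>K\<close> will yield stability under its
  inverse.\<close>

lemma inverse_stable:
  assumes "Vector_Spaces.linear scale scale L" and L: "\<And>x. L (K x) = x"
    and U: "subspace U" "K ` U \<subseteq> U"
  shows "L ` U \<subseteq> U"
proof
  fix y assume "y \<in> L ` U"
  then obtain x where x: "x \<in> U" "y = L x" by blast
  have Lp: "L (proj m x) \<in> U" for m
  proof -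
    have "(q powi m) *s L (proj m x) = proj m x"
      using L[of "proj m x"] proj_in_wt[of m x] by (simp add: wt_def self.linear_scale[OF assms(1)])
    then have "L (proj m x) = inverse (q powi m) *s proj m x"
      using q_nonzero by (metis left_inverse power_int_eq_0_iff scale_one scale_scale)
    then show ?thesis using subspace_scale[OF U(1)] proj_stable[OF U x(1)] by simp
  qed
  have "L x = (\<Sum>m\<in>M. L (proj m x))"
    using self.linear_sum[OF assms(1), of "\<lambda>m. proj m x" M] by (simp add: sum_proj)
  also have "\<dots> \<in> U" using Lp by (intro subspace_sum U(1))
  finally show "y \<in> U" using x by simp
qed

end

subsection \<open>Representations of quantum \<open>sl\<^sub>2\<close>\<close>

text \<open>Weights are exponents of \<open>q\<close> and not of \<open>q ^ d\<close>, to match the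
  type 1 condition; hence the shifts by \<open>2 * int d\<close>. Divisibility of the weights by
  \<open>d\<close> is derived in \<open>d_dvd_weight\<close>.\<close>

locale sl2_operators = weight_operator scale q K M
  for scale :: "'a::field \<Rightarrow> 'v::ab_group_add \<Rightarrow> 'v" (infixr \<open>*s\<close> 75)
    and q :: 'a and K :: "'v \<Rightarrow> 'v" and M :: "int set" +
  fixes E F :: "'v \<Rightarrow> 'v" and d :: nat
  assumes d_pos: "d > 0"
    and linear_E: "Vector_Spaces.linear scale scale E"
    and linear_F: "Vector_Spaces.linear scale scale F"
    and E_wt: "x \<in> wt m \<Longrightarrow> E x \<in> wt (m + 2 * int d)"
    and F_wt: "x \<in> wt m \<Longrightarrow> F x \<in> wt (m - 2 * int d)"
    and commutator: "x \<in> wt m \<Longrightarrow> E (F x) - F (E x) =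
      ((q powi m - q powi (- m)) / (q ^ d - inverse (q ^ d))) *s x"
begin

text \<open>For \<open>m = d * k\<close> this is the quantum integer [k] with parameter
  \<open>q ^ d\<close>.\<close>

definition qwt :: "int \<Rightarrow> 'a" where
  "qwt m = (q powi m - q powi (- m)) / (q ^ d - inverse (q ^ d))"

lemma EF: "x \<in> wt m \<Longrightarrow> E (F x) = F (E x) + qwt m *s x"
  using commutator[of x m] by (simp add: qwt_def algebra_simps)

section \<open>Powers of the raising and lowering operators on weight vectors\<close>

lemma E_pow_wt: "x \<in> wt m \<Longrightarrow> (E ^^ r) x \<in> wt (m + 2 * int d * int r)"
proof (induction r)
  case (Suc r)
  then show ?case using E_wt[of "(E ^^ r) x" "m + 2 * int d * int r"] by (simp add: algebra_simps)
qed simp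

lemma F_pow_wt: "x \<in> wt m \<Longrightarrow> (F ^^ r) x \<in> wt (m - 2 * int d * int r)"
proof (induction r)
  case (Suc r)
  then show ?case using F_wt[of "(F ^^ r) x" "m - 2 * int d * int r"] by (simp add: algebra_simps)
qed simp

lemma linear_E_pow: "Vector_Spaces.linear scale scale (E ^^ r)"
proof (induction r)
  case 0
  then show ?case using linear_id by (simp add: id_def)
next
  case (Suc r)
  then show ?case using Vector_Spaces.linear_compose[OF Suc linear_E] by (simp only: funpow.simps)
qed

lemma linear_F_pow: "Vector_Spaces.linear scale scale (F ^^ r)"
proof (induction r)
  case 0
  then show ?case using linear_id by (simp add: id_def)
next
  case (Suc r)
  then show ?case using Vector_Spaces.linear_compose[OF Suc linear_F] by (simp only: funpow.simps)
qed

text \<open>An arithmetic progression with nonzero step is infinite, while \<open>M\<close> is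
  finite. This makes \<open>E\<close> and \<open>F\<close> nilpotent on weight vectors.\<close>

lemma wt_escape:
  assumes "c \<noteq> 0"
  obtains r :: nat where "m + c * int r \<notin> M"
proof -
  have "inj (\<lambda>r. m + c * int r)" using assms by (auto simp: inj_def)
  then have "infinite (range (\<lambda>r. m + c * int r))" using finite_imageD infinite_UNIV_nat by blast
  then have "\<not> range (\<lambda>r. m + c * int r) \<subseteq> M" using finite_M finite_subset by blast
  then show ?thesis using that by blast
qed

lemma E_nilpotent: assumes "x \<in> wt m" obtains r where "(E ^^ r) x = 0"
proof -
  obtain r :: nat where "m + 2 * int d * int r \<notin> M" using wt_escape[of "2 * int d" m] d_pos by auto
  then show ?thesis using that wt_outside[OF E_pow_wt[OF assms]] by blast
qed

lemma F_nilpotent: assumes "x \<in> wt m" obtains r where "(F ^^ r) x = 0"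
proof -
  obtain r :: nat where "m + (- 2 * int d) * int r \<notin> M" using wt_escape[of "- 2 * int d" m] d_pos by auto
  then show ?thesis using that[of r] wt_outside[OF F_pow_wt[OF assms, of r]] by auto
qed

text \<open>\<open>E\<close> is moved past the factors \<open>F\<close> one by one; each passage
  costs the scalar \<open>qwt\<close> at the weight \<open>m - 2 * d * j\<close> of
  \<open>(F ^^ j) x\<close>.\<close>

lemma F_pow_E:
  assumes "x \<in> wt m"
  shows "(F ^^ Suc a) (E x) = E ((F ^^ Suc a) x) - (\<Sum>j\<le>a. qwt (m - 2 * int d * int j)) *s (F ^^ a) x"
proof (induction a)
  case 0
  then show ?case using EF[OF assms] by simp
next
  case (Suc a)
  let ?S = "\<lambda>a. \<Sum>j\<le>a. qwt (m - 2 * int d * int j)"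
  have "(F ^^ Suc (Suc a)) (E x) = F (E ((F ^^ Suc a) x)) - ?S a *s (F ^^ Suc a) x"
    using Suc by (simp add: self.linear_diff[OF linear_F] self.linear_scale[OF linear_F])
  also have "F (E ((F ^^ Suc a) x)) =
      E ((F ^^ Suc (Suc a)) x) - qwt (m - 2 * int d * int (Suc a)) *s (F ^^ Suc a) x"
    using EF[OF F_pow_wt[OF assms, of "Suc a"]] by simp
  finally show ?case by (simp add: scale_left_distrib)
qed

text \<open>The scalar stays unspecified because the correction term will only be tested for
  membership in a subspace.\<close>

lemma E_pow_F:
  assumes "x \<in> wt m"
  shows "\<exists>c. (E ^^ Suc r) (F x) = F ((E ^^ Suc r) x) + c *s (E ^^ r) x"
proof (induction r)
  case 0
  then show ?case using EF[OF assms] by auto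
next
  case (Suc r)
  then obtain c where "(E ^^ Suc r) (F x) = F ((E ^^ Suc r) x) + c *s (E ^^ r) x" by blast
  then have "(E ^^ Suc (Suc r)) (F x) = E (F ((E ^^ Suc r) x)) + c *s (E ^^ Suc r) x"
    by (simp add: self.linear_add[OF linear_E] self.linear_scale[OF linear_E])
  also have "\<dots> = F ((E ^^ Suc (Suc r)) x) +
      (qwt (m + 2 * int d * int (Suc r)) + c) *s (E ^^ Suc r) x"
    using EF[OF E_pow_wt[OF assms, of "Suc r"]] by (simp add: scale_left_distrib algebra_simps)
  finally show ?case by blast
qed

section \<open>Sums of quantum integers and the length of lowering strings\<close>

lemma qdiff_nonzero: "q ^ d - inverse (q ^ d) \<noteq> 0"
proof
  assume "q ^ d - inverse (q ^ d) = 0"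
  then have "q powi (int d) = q powi (- int d)"
    by (simp add: power_int_minus)
  then have "int d = - int d" using powi_eq_iff by blast
  then show False using d_pos by simp
qed

text \<open>With \<open>g s = q powi s + q powi (- s)\<close>, each \<open>qwt k\<close> times the
  square is \<open>g (k + d) - g (k - d)\<close>, so the sum over weights in steps of
  \<open>2 * d\<close> telescopes.\<close>

lemma sum_qwt:
  "(\<Sum>j\<le>a. qwt (m - 2 * int d * int j)) * (q ^ d - inverse (q ^ d)) ^ 2 =
     q powi (m + int d) + q powi (- m - int d)
     - q powi (m - 2 * int d * int a - int d) - q powi (- m + 2 * int d * int a + int d)"
proof -
  let ?e = "q ^ d - inverse (q ^ d)"
  have e: "?e = q powi int d - q powi (- int d)" by (simp add: power_int_minus)
  have powi_mult: "q powi a * q powi b = q powi (a + b)" for a b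
    using q_nonzero by (simp add: power_int_add)
  have qwt_e: "qwt k * ?e ^ 2 = q powi (k + int d) + q powi (- k - int d)
      - q powi (k - int d) - q powi (- k + int d)" for k
  proof -
    have "qwt k * ?e ^ 2 = (q powi k - q powi (- k)) * ?e"
      using qdiff_nonzero by (simp add: qwt_def power2_eq_square)
    also have "\<dots> = q powi (k + int d) + q powi (- k - int d)
        - q powi (k - int d) - q powi (- k + int d)"
      unfolding e by (simp only: left_diff_distrib right_diff_distrib powi_mult) (simp add: algebra_simps)
    finally show ?thesis .
  qed
  show ?thesis
  proof (induction a)
    case 0
    then show ?case using qwt_e[of m] by simp
  next
    case (Suc a)
    then show ?case using qwt_e[of "m - 2 * int d * int (Suc a)"]
      by (simp add: distrib_right algebra_simps)
  qed
qed

text \<open>The telescoped sum factors as \<open>(?x - ?y) * (?x * ?y - 1)\<close> up to a nonzero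
  factor. The first factor cannot vanish, since the exponents differ by
  \<open>2 * d * (a + 1)\<close>; the second vanishes only for \<open>m = d * a\<close>.\<close>

lemma sum_qwt_zero:
  assumes "(\<Sum>j\<le>a. qwt (m - 2 * int d * int j)) = 0"
  shows "m = int d * int a"
proof -
  let ?x = "q powi (m + int d)" and ?y = "q powi (m - 2 * int d * int a - int d)"
  have inv: "q powi (- m - int d) = inverse ?x"
      "q powi (- m + 2 * int d * int a + int d) = inverse ?y"
    by (simp_all add: algebra_simps flip: power_int_minus)
  have nz: "?x \<noteq> 0" "?y \<noteq> 0" using q_nonzero by auto
  have "?x + inverse ?x - ?y - inverse ?y = 0"
    using sum_qwt[of m a] assms inv by simp
  then have "(?x - ?y) * (?x * ?y - 1) = 0"
    using nz by (simp add: field_simps)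
  then have "?x = ?y \<or> ?x * ?y = 1" by simp
  then show ?thesis
  proof
    assume "?x = ?y"
    then have "2 * int d * int (Suc a) = 0" by (simp add: powi_eq_iff algebra_simps)
    then show ?thesis using d_pos by simp
  next
    assume "?x * ?y = 1"
    then have "q powi (m + int d + (m - 2 * int d * int a - int d)) = 1"
      by (subst power_int_add) (use q_nonzero in auto)
    then have "m + int d + (m - 2 * int d * int a - int d) = 0" by (rule q_not_root_of_unity)
    then show ?thesis by simp
  qed
qed

text \<open>By \<open>F_pow_E\<close>, each application of \<open>E\<close> lengthens the string of
  nonzero \<open>F\<close>-powers by exactly one unless the scalar \<open>?S\<close> vanishes. By
  \<open>sum_qwt_zero\<close> at weight \<open>m + 2 * d * r\<close>, that happens only for
  \<open>m = d * (a - r)\<close>, which is excluded.\<close>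

lemma F_pow_E_pow_nonzero:
  assumes x: "x \<in> wt m" "(F ^^ a) x \<noteq> 0" "(F ^^ Suc a) x = 0"
    and m: "\<And>r'. r' < r \<Longrightarrow> m \<noteq> int d * (int a - int r')"
  shows "(F ^^ (a + r)) ((E ^^ r) x) \<noteq> 0 \<and> (F ^^ Suc (a + r)) ((E ^^ r) x) = 0"
  using m
proof (induction r)
  case 0
  then show ?case using x by simp
next
  case (Suc r)
  let ?y = "(E ^^ r) x" and ?n = "m + 2 * int d * int r"
  let ?S = "\<Sum>j\<le>a + r. qwt (?n - 2 * int d * int j)"
  have y: "?y \<in> wt ?n" by (rule E_pow_wt[OF x(1)])
  have IH: "(F ^^ (a + r)) ?y \<noteq> 0" "(F ^^ Suc (a + r)) ?y = 0"
    using Suc by auto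
  have S: "?S \<noteq> 0"
    using sum_qwt_zero[of ?n "a + r"] Suc.prems[of r] by (auto simp: algebra_simps)
  have "(F ^^ Suc (a + r)) (E ?y) = - (?S *s (F ^^ (a + r)) ?y)"
    using F_pow_E[OF y, of "a + r"] IH(2) by (simp add: self.linear_0[OF linear_E])
  moreover have "(F ^^ Suc (Suc (a + r))) (E ?y) = F ((F ^^ Suc (a + r)) (E ?y))" by simp
  moreover have "F ((F ^^ (a + r)) ?y) = 0" using IH(2) by simp
  ultimately show ?case using S IH(1)
    by (simp add: self.linear_neg[OF linear_F] self.linear_scale[OF linear_F])
qed

lemma last_F_pow:
  assumes "x \<in> wt m" "x \<noteq> 0"
  obtains a where "(F ^^ a) x \<noteq> 0" "(F ^^ Suc a) x = 0"
proof -
  obtain r where r: "(F ^^ r) x = 0" using F_nilpotent[OF assms(1)] .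
  define s where "s = (LEAST s. (F ^^ s) x = 0)"
  have s: "(F ^^ s) x = 0" unfolding s_def using r by (rule LeastI)
  then have "s \<noteq> 0" using assms(2) by (intro notI) simp
  then obtain a where a: "s = Suc a" using not0_implies_Suc by blast
  have "(F ^^ a) x \<noteq> 0" using not_less_Least[of a "\<lambda>s. (F ^^ s) x = 0"] a by (simp add: s_def)
  then show ?thesis using that s a by blast
qed

text \<open>As \<open>E\<close> is nilpotent on \<open>x\<close>, the growth of the string must
  break off, and it can do so only at an exceptional weight \<open>d * (a - r')\<close>.\<close>

lemma d_dvd_weight:
  assumes "x \<in> wt m" "x \<noteq> 0"
  shows "int d dvd m"
proof -
  obtain a where a: "(F ^^ a) x \<noteq> 0" "(F ^^ Suc a) x = 0" using last_F_pow[OF assms] .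
  obtain r where r: "(E ^^ r) x = 0" using E_nilpotent[OF assms(1)] .
  have "\<exists>r'<r. m = int d * (int a - int r')"
    using F_pow_E_pow_nonzero[OF assms(1) a, of r] r self.linear_0[OF linear_F_pow] by auto
  then show ?thesis by auto
qed

text \<open>At weight \<open>- d * R\<close> an exceptional index would be
  \<open>r' = a + R\<close>, which is not below \<open>R\<close>; so the string keeps growing
  through all \<open>R\<close> steps.\<close>

lemma E_pow_inj:
  assumes "x \<in> wt (- int d * int R)" "(E ^^ R) x = 0"
  shows "x = 0"
proof (rule ccontr)
  assume "x \<noteq> 0"
  obtain a where a: "(F ^^ a) x \<noteq> 0" "(F ^^ Suc a) x = 0" using last_F_pow[OF assms(1) \<open>x \<noteq> 0\<close>] .
  have "- int d * int R \<noteq> int d * (int a - int r')" if "r' < R" for r'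
  proof
    assume "- int d * int R = int d * (int a - int r')"
    then have "int d * (int a - int r' + int R) = 0" by (simp add: algebra_simps)
    then show False using d_pos that by simp
  qed
  then have "(F ^^ (a + R)) ((E ^^ R) x) \<noteq> 0"
    using F_pow_E_pow_nonzero[OF assms(1) a, of R] by blast
  then show False using assms(2) self.linear_0[OF linear_F_pow] by simp
qed

lemma E_pow_stable: "E ` W \<subseteq> W \<Longrightarrow> x \<in> W \<Longrightarrow> (E ^^ r) x \<in> W"
  by (induction r) auto

text \<open>As \<open>E ^^ (R + 2)\<close> is injective on weight \<open>- d * (R + 2)\<close> and onto the opposite part of \<open>W\<close>,
  whether \<open>F w\<close> lies in \<open>W\<close> can be tested after applying it. Commuting it past \<open>F\<close> reduces the claim
  for weight \<open>- d * R\<close> to the one for \<open>- d * (R + 4)\<close>.\<close>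

lemma F_stable:
  assumes W: "subspace W" "E ` W \<subseteq> W" "K ` W \<subseteq> W"
    and onto: "\<And>R x. x \<in> W \<Longrightarrow> x \<in> wt (int d * int R) \<Longrightarrow>
      \<exists>y\<in>W \<inter> wt (- int d * int R). x = (E ^^ R) y"
  shows "F ` W \<subseteq> W"
proof -
  define P where "P R \<longleftrightarrow> (\<forall>w \<in> W \<inter> wt (- int d * int R). F w \<in> W)" for R
  \<comment> \<open>The claim passes from weight \<open>- d * R\<close> to \<open>d * R\<close>:
    write \<open>x = (E ^^ R) y\<close> and move \<open>F\<close> past \<open>E ^^ R\<close>, at the
    cost of a term in \<open>W\<close>.\<close>
  have up: "F x \<in> W" if P: "P R" and x: "x \<in> W" "x \<in> wt (int d * int R)" for R x
  proof (cases R)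
    case 0
    then show ?thesis using P x by (simp add: P_def)
  next
    case (Suc r)
    obtain y where y: "y \<in> W" "y \<in> wt (- int d * int R)" "x = (E ^^ R) y"
      using onto[OF x] by blast
    obtain c where c: "(E ^^ R) (F y) = F ((E ^^ R) y) + c *s (E ^^ r) y"
      using E_pow_F[OF y(2), of r] Suc by blast
    have "F x = (E ^^ R) (F y) - c *s (E ^^ r) y" using c y(3) by simp
    moreover have "F y \<in> W" using P y by (auto simp: P_def)
    ultimately show ?thesis
      using E_pow_stable[OF W(2)] y(1) subspace_diff[OF W(1)] subspace_scale[OF W(1)] by simp
  qed
  have down: "P R" if P: "P (R + 4)" for R
    unfolding P_def
  proof
    fix w assume w: "w \<in> W \<inter> wt (- int d * int R)"
    have "(E ^^ (R + 2)) w \<in> wt (- int d * int R + 2 * int d * int (R + 2))"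
      using E_pow_wt w by blast
    then have "(E ^^ (R + 2)) w \<in> wt (int d * int (R + 4))"
      by (simp add: algebra_simps)
    then have 1: "F ((E ^^ (R + 2)) w) \<in> W"
      using up[OF P] E_pow_stable[OF W(2)] w by blast
    obtain c where c: "(E ^^ Suc (R + 1)) (F w) = F ((E ^^ Suc (R + 1)) w) + c *s (E ^^ (R + 1)) w"
      using E_pow_F w by blast
    have "(E ^^ Suc (R + 1)) (F w) \<in> W"
      unfolding c using 1 w by (intro subspace_add subspace_scale W(1) E_pow_stable[OF W(2)]) auto
    then have 2: "(E ^^ (R + 2)) (F w) \<in> W" by simp
    have Fw: "F w \<in> wt (- int d * int (R + 2))"
      using F_wt w by (force simp: algebra_simps)
    have "(E ^^ (R + 2)) (F w) \<in> wt (- int d * int (R + 2) + 2 * int d * int (R + 2))"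
      by (rule E_pow_wt[OF Fw])
    then have "(E ^^ (R + 2)) (F w) \<in> wt (int d * int (R + 2))" by (simp add: algebra_simps)
    then obtain y where y: "y \<in> W" "y \<in> wt (- int d * int (R + 2))" "(E ^^ (R + 2)) (F w) = (E ^^ (R + 2)) y"
      using onto[OF 2] by blast
    have "F w - y = 0"
    proof (rule E_pow_inj)
      show "F w - y \<in> wt (- int d * int (R + 2))" using Fw y(2) subspace_diff[OF subspace_wt] by blast
      show "(E ^^ (R + 2)) (F w - y) = 0" 
        by (simp only: self.linear_diff[OF linear_E_pow] y(3)) simp
    qed
    then show "F w \<in> W" using y(1) by simp
  qed
  \<comment> \<open>Steps of 4 lead to a weight outside \<open>M\<close>, where only the zero vector
    lives; \<open>down\<close> then returns to \<open>R\<close>.\<close>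
  have P: "P R" for R
  proof -
    obtain k :: nat where "- int d * int R + (- 4 * int d) * int k \<notin> M"
      using wt_escape[of "- 4 * int d" "- int d * int R"] d_pos by auto
    then have k: "- int d * int (R + 4 * k) \<notin> M" by (simp add: algebra_simps)
    have "P (R + 4 * (k - j))" if "j \<le> k" for j
      using that
    proof (induction j)
      case 0
      have "F w \<in> W" if "w \<in> wt (- int d * int (R + 4 * k))" for w
        using wt_outside[OF that k] self.linear_0[OF linear_F] subspace_0[OF W(1)] by simp
      then show ?case by (simp add: P_def)
    next
      case (Suc j)
      then have "P (R + 4 * (k - j))" "k - j = Suc (k - Suc j)" by simp_all
      then show ?case using down[of "R + 4 * (k - Suc j)"] by (simp add: algebra_simps)
    qed
    from this[of k] show ?thesis by simp
  qed
  have wtF: "F w \<in> W" if w: "w \<in> W" "w \<in> wt m" for w m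
  proof (cases "w = 0")
    case True
    then show ?thesis using self.linear_0[OF linear_F] subspace_0[OF W(1)] by simp
  next
    case False
    then obtain k where k: "m = int d * k" using d_dvd_weight[OF w(2)] by (auto simp: dvd_def)
    show ?thesis
    proof (cases "k \<ge> 0")
      case True
      then show ?thesis using up[OF P, of w "nat k"] w k by simp
    next
      case False
      then show ?thesis using P[of "nat (- k)"] w k by (simp add: P_def)
    qed
  qed
  show ?thesis
  proof
    fix y assume "y \<in> F ` W"
    then obtain x where x: "x \<in> W" "y = F x" by blast
    have "F x = (\<Sum>m\<in>M. F (proj m x))"
      using self.linear_sum[OF linear_F, of "\<lambda>m. proj m x" M] by (simp add: sum_proj)
    also have "\<dots> \<in> W"
      using wtF proj_stable[OF W(1,3) x(1)] proj_in_wt by (intro subspace_sum W(1)) blast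
    finally show "y \<in> W" using x by simp
  qed
qed

section \<open>Sum of the weights of a subspace stable under the raising operator\<close>

context
  fixes B W :: "'v set" and lam :: "'v \<Rightarrow> int"
  assumes finite_B: "finite B" and indep: "independent B"
    and B_wt: "\<And>b. b \<in> B \<Longrightarrow> b \<in> wt (lam b)"
    and W: "W = span B" and E_W: "E ` W \<subseteq> W"
begin

abbreviation "part m \<equiv> {b \<in> B. lam b = m}"

lemma part_subset_wt: "span (part m) \<subseteq> wt m"
  using B_wt by (intro span_minimal subspace_wt) auto

lemma part_subset_W: "span (part m) \<subseteq> W"
  unfolding W by (intro span_mono) auto

lemma weight_vector_in_span_part: "x \<in> W \<Longrightarrow> x \<in> wt m \<Longrightarrow> x \<in> span (part m)"
  using proj_span_weight_vectors[of B lam x m] B_wt W by simp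

text \<open>\<open>E_pow_inj\<close>, applied to differences, makes \<open>E ^^ R\<close> injective
  on the weight part. Stability of \<open>W\<close> under \<open>E\<close> places the image in the
  part of opposite weight.\<close>

lemma E_pow_image_part:
  shows "independent ((E ^^ R) ` part (- int d * int R))"
    and "(E ^^ R) ` part (- int d * int R) \<subseteq> span (part (int d * int R))"
    and "card ((E ^^ R) ` part (- int d * int R)) = card (part (- int d * int R))"
proof -
  let ?B = "part (- int d * int R)"
  have inj: "inj_on (E ^^ R) (span ?B)"
  proof (rule inj_onI)
    fix x y assume xy: "x \<in> span ?B" "y \<in> span ?B" "(E ^^ R) x = (E ^^ R) y"
    then have "x - y \<in> wt (- int d * int R)" using span_diff part_subset_wt by blast
    moreover have "(E ^^ R) (x - y) = 0" using xy(3) by (simp add: self.linear_diff[OF linear_E_pow])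
    ultimately show "x = y" using E_pow_inj by force
  qed
  have "independent ?B" using independent_mono[OF indep] by simp
  then show "independent ((E ^^ R) ` ?B)"
    using self.linear_independent_injective_image[OF linear_E_pow _ inj] by blast
  show "card ((E ^^ R) ` ?B) = card ?B"
    using inj by (intro card_image) (rule inj_on_subset, auto intro: span_base)
  show "(E ^^ R) ` ?B \<subseteq> span (part (int d * int R))"
  proof
    fix y assume "y \<in> (E ^^ R) ` ?B"
    then obtain b where b: "b \<in> ?B" "y = (E ^^ R) b" by blast
    have "b \<in> wt (- int d * int R)" using B_wt[of b] b(1) by auto
    then have "y \<in> wt (int d * int R)"
      using E_pow_wt[of b "- int d * int R" R] b(2) by (simp add: algebra_simps)
    moreover have "y \<in> W" using b W E_pow_stable[OF E_W] by (simp add: span_base)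
    ultimately show "y \<in> span (part (int d * int R))" by (rule weight_vector_in_span_part[rotated])
  qed
qed

text \<open>If \<open>d\<close> divides \<open>m\<close>, this compares an independent image with a
  spanning set. Otherwise \<open>part (- m)\<close> is empty by \<open>d_dvd_weight\<close>.\<close>

lemma card_part_le: "m \<ge> 0 \<Longrightarrow> card (part (- m)) \<le> card (part m)"
proof (cases "int d dvd m")
  case True
  assume "m \<ge> 0"
  obtain k where k: "m = int d * k" using True by (auto simp: dvd_def)
  then have "k \<ge> 0" using \<open>m \<ge> 0\<close> d_pos by (simp add: zero_le_mult_iff)
  then have m: "m = int d * int (nat k)" "- m = - int d * int (nat k)" using k by simp_all
  show ?thesis
    using independent_span_bound[OF _ E_pow_image_part(1,2)[of "nat k"]] finite_B
      E_pow_image_part(3)[of "nat k"] unfolding m by simp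
next
  case False
  have "part (- m) = {}"
  proof (rule ccontr)
    assume "part (- m) \<noteq> {}"
    then obtain b where b: "b \<in> B" "lam b = - m" by auto
    then have "b \<noteq> 0" using indep dependent_zero by blast
    then have "int d dvd - m" using d_dvd_weight B_wt[OF b(1)] b(2) by metis
    then show False using False by simp
  qed
  then show ?thesis by (simp only: card.empty le0)
qed

text \<open>The sum is grouped by weight over a symmetric range and added to its reflection under
  \<open>m\<close> to \<open>- m\<close>. This pairs opposite weights and explains the factor
  2.\<close>

lemma twice_sum_weights:
  obtains N :: int where "\<And>b. b \<in> B \<Longrightarrow> \<bar>lam b\<bar> \<le> N"
    "2 * (\<Sum>b\<in>B. lam b) = (\<Sum>m\<in>{-N..N}. m * (int (card (part m)) - int (card (part (- m)))))"
proof -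
  define N where "N = Max (insert 0 ((\<lambda>b. \<bar>lam b\<bar>) ` B))"
  have N: "\<bar>lam b\<bar> \<le> N" if "b \<in> B" for b
    unfolding N_def using finite_B that by (intro Max_ge) auto
  have "lam b \<in> {-N..N}" if "b \<in> B" for b
    using N[OF that] by auto
  then have "(\<Sum>b\<in>B. lam b) = (\<Sum>m\<in>{-N..N}. \<Sum>b\<in>part m. lam b)"
    using finite_B by (intro sum.group[symmetric]) auto
  also have "\<dots> = (\<Sum>m\<in>{-N..N}. m * int (card (part m)))"
  proof (rule sum.cong)
    fix m
    have "(\<Sum>b\<in>part m. lam b) = (\<Sum>b\<in>part m. m)" by (rule sum.cong) auto
    then show "(\<Sum>b\<in>part m. lam b) = m * int (card (part m))" by (simp only: sum_constant mult.commute)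
  qed simp
  finally have 1: "(\<Sum>b\<in>B. lam b) = (\<Sum>m\<in>{-N..N}. m * int (card (part m)))" .
  also have "\<dots> = (\<Sum>m\<in>{-N..N}. - m * int (card (part (- m))))"
    by (rule sum.reindex_bij_witness[where i = uminus and j = uminus]) auto
  finally have 2: "(\<Sum>b\<in>B. lam b) = (\<Sum>m\<in>{-N..N}. - m * int (card (part (- m))))" .
  have "2 * (\<Sum>b\<in>B. lam b) = (\<Sum>m\<in>{-N..N}. m * int (card (part m)) + - m * int (card (part (- m))))"
    unfolding sum.distrib using 1 2 by linarith
  then show ?thesis using that[OF N] by (simp add: right_diff_distrib)
qed

lemma weight_term_nonneg: "0 \<le> m * (int (card (part m)) - int (card (part (- m))))"
proof (cases "m \<ge> 0")
  case True
  then show ?thesis using card_part_le[of m] by simp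
next
  case False
  then show ?thesis using card_part_le[of "- m"] by (intro mult_nonpos_nonpos) auto
qed

lemma sum_weights_nonneg: "0 \<le> (\<Sum>b\<in>B. lam b)"
proof -
  obtain N where N: "2 * (\<Sum>b\<in>B. lam b) = (\<Sum>m\<in>{-N..N}. m * (int (card (part m)) - int (card (part (- m)))))"
    using twice_sum_weights by blast
  have "0 \<le> (\<Sum>m\<in>{-N..N}. m * (int (card (part m)) - int (card (part (- m)))))"
    by (intro sum_nonneg weight_term_nonneg)
  then show ?thesis using N by simp
qed

text \<open>The terms in \<open>twice_sum_weights\<close> are nonnegative, so a zero sum makes each
  of them zero. For \<open>m = 0\<close> the two parts coincide, and beyond \<open>N\<close> both
  are empty.\<close>

lemma card_part_eq:
  assumes "(\<Sum>b\<in>B. lam b) = 0"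
  shows "card (part (- m)) = card (part m)"
proof -
  obtain N where N: "\<And>b. b \<in> B \<Longrightarrow> \<bar>lam b\<bar> \<le> N"
      "2 * (\<Sum>b\<in>B. lam b) = (\<Sum>m\<in>{-N..N}. m * (int (card (part m)) - int (card (part (- m)))))"
    using twice_sum_weights by blast
  show ?thesis
  proof (cases "m \<in> {-N..N}")
    case True
    have "(\<Sum>m\<in>{-N..N}. m * (int (card (part m)) - int (card (part (- m))))) = 0"
      using N(2) assms by simp
    then have "\<forall>m\<in>{-N..N}. m * (int (card (part m)) - int (card (part (- m)))) = 0"
      by (subst (asm) sum_nonneg_eq_0_iff) (use weight_term_nonneg in auto)
    then have "m * (int (card (part m)) - int (card (part (- m)))) = 0" using True by blast
    then show ?thesis by (cases "m = 0") auto
  next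
    case False
    then have "part m = {}" "part (- m) = {}" using N(1) by (force simp: abs_le_iff)+
    then show ?thesis by (simp only: card.empty)
  qed
qed

text \<open>The image of the basis at weight \<open>- d * R\<close> is independent and, by
  \<open>card_part_eq\<close>, as large as the basis at weight \<open>d * R\<close>; hence it spans
  that part.\<close>

lemma E_pow_onto:
  assumes sum: "(\<Sum>b\<in>B. lam b) = 0" and x: "x \<in> W" "x \<in> wt (int d * int R)"
  shows "\<exists>y\<in>W \<inter> wt (- int d * int R). x = (E ^^ R) y"
proof -
  let ?N = "part (- int d * int R)" and ?P = "part (int d * int R)"
  let ?S = "(E ^^ R) ` ?N"
  have card: "card ?S = card ?P"
    using E_pow_image_part(3)[of R] card_part_eq[OF sum, of "int d * int R"] by simp
  have "?P \<subseteq> span ?S"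
  proof
    fix t assume t: "t \<in> ?P"
    show "t \<in> span ?S"
    proof (rule ccontr)
      assume not: "t \<notin> span ?S"
      then have "independent (insert t ?S)" by (rule independent_insertI[OF _ E_pow_image_part(1)])
      moreover have "insert t ?S \<subseteq> span ?P" using E_pow_image_part(2)[of R] span_base[OF t] by simp
      ultimately have "card (insert t ?S) \<le> card ?P"
        using independent_span_bound[of ?P] finite_B by simp
      moreover have "t \<notin> ?S" using not by (meson span_base)
      ultimately show False using card finite_B by simp
    qed
  qed
  then have "span ?P \<subseteq> span ?S" by (intro span_minimal subspace_span)
  moreover have "x \<in> span ?P" using weight_vector_in_span_part x by blast
  moreover have "span ?S = (E ^^ R) ` span ?N" by (rule self.linear_span_image[OF linear_E_pow])
  ultimately obtain y where "y \<in> span ?N" "x = (E ^^ R) y" by blast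
  then show ?thesis using part_subset_wt part_subset_W by blast
qed

end

end

subsection \<open>Raising operators act irreducibly\<close>

context vector_space
begin

text \<open>Simultaneous diagonalisation on a stable subspace: the \<open>K j\<close>-components of
  a vector stay in \<open>W\<close> and, since the operators commute, remain eigenvectors of the
  operators treated before.\<close>

lemma joint_weight_vectors_span:
  assumes op: "\<And>i. i \<in> I \<Longrightarrow> weight_operator scale q (K i) (M i)" and "finite I"
    and comm: "\<And>i j x. i \<in> I \<Longrightarrow> j \<in> I \<Longrightarrow> K i (K j x) = K j (K i x)"
    and W: "subspace W" "\<And>i. i \<in> I \<Longrightarrow> K i ` W \<subseteq> W"
  shows "W \<subseteq> span {x \<in> W. \<forall>i\<in>I. \<exists>m. K i x = (q powi m) *s x}"
  using \<open>finite I\<close> op comm W(2)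
proof (induction I rule: finite_induct)
  case empty
  then show ?case by (simp add: span_superset)
next
  case (insert j J)
  interpret j: weight_operator scale q "K j" "M j" by (rule insert.prems(1)) simp
  let ?S = "\<lambda>J. {x \<in> W. \<forall>i\<in>J. \<exists>m. K i x = (q powi m) *s x}"
  have "W \<subseteq> span (?S J)"
    by (rule insert.IH) (use insert.prems in auto)
  moreover have "?S J \<subseteq> span (?S (insert j J))"
  proof
    fix y assume y: "y \<in> ?S J"
    have "j.proj m y \<in> ?S (insert j J)" for m
    proof -
      have "j.proj m y \<in> W" using y W(1) insert.prems(3) by (intro j.proj_stable) auto
      moreover have "K j (j.proj m y) = (q powi m) *s j.proj m y"
        using j.proj_in_wt[of m y] by (simp add: j.wt_def)
      moreover have "\<exists>k. K i (j.proj m y) = (q powi k) *s j.proj m y" if i: "i \<in> J" for i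
      proof -
        obtain k where k: "K i y = (q powi k) *s y" using y i by blast
        interpret i: weight_operator scale q "K i" "M i" by (rule insert.prems(1)) (simp add: i)
        have "j.proj m (K i y) = K i (j.proj (m - 0) y)"
        proof (rule j.proj_homogeneous[OF i.linear_K])
          fix n x assume "x \<in> j.wt n"
          then show "K i x \<in> j.wt (n + 0)"
            using insert.prems(2)[of j i x] i by (simp add: j.wt_def j.self.linear_scale[OF i.linear_K])
        qed
        then have "K i (j.proj m y) = (q powi k) *s j.proj m y"
          using k by (simp add: j.self.linear_scale[OF j.linear_proj])
        then show ?thesis by blast
      qed
      ultimately show ?thesis by blast
    qed
    then have "(\<Sum>m\<in>M j. j.proj m y) \<in> span (?S (insert j J))"
      by (intro span_sum span_base)
    then show "y \<in> span (?S (insert j J))" by (simp add: j.sum_proj)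
  qed
  ultimately show ?case using span_minimal[OF _ subspace_span] by blast
qed

text \<open>\<open>T\<close> plays the finite-dimensional module inside a possibly larger space. The
  assumption \<open>level_zero\<close> is the relation that the product of the \<open>K i\<close> to
  the powers \<open>a i\<close> is 1, read off on joint weight vectors.\<close>

theorem raising_operators_irreducible:
  fixes a :: "'i \<Rightarrow> int"
  assumes sl2: "\<And>i. i \<in> I \<Longrightarrow> sl2_operators scale q (K i) (M i) (E i) (F i) (d i)"
    and finite_I: "finite I"
    and comm: "\<And>i j x. i \<in> I \<Longrightarrow> j \<in> I \<Longrightarrow> K i (K j x) = K j (K i x)"
    and KE: "\<And>i j m x. i \<in> I \<Longrightarrow> j \<in> I \<Longrightarrow> K i x = (q powi m) *s x \<Longrightarrow>
      K i (E j x) = (q powi (m + r i j)) *s E j x"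
    and a_pos: "\<And>i. i \<in> I \<Longrightarrow> a i > 0"
    and level_zero: "\<And>x lam. x \<noteq> 0 \<Longrightarrow> (\<And>i. i \<in> I \<Longrightarrow> K i x = (q powi lam i) *s x) \<Longrightarrow>
      (\<Sum>i\<in>I. a i * lam i) = 0"
    and T: "subspace T" "finite S" "T \<subseteq> span S" "\<And>i. i \<in> I \<Longrightarrow> K i ` T \<subseteq> T"
    and irreducible: "\<And>W. subspace W \<Longrightarrow> W \<subseteq> T \<Longrightarrow>
      (\<And>i. i \<in> I \<Longrightarrow> E i ` W \<subseteq> W \<and> F i ` W \<subseteq> W \<and> K i ` W \<subseteq> W) \<Longrightarrow> W = {0} \<or> W = T"
    and W: "subspace W" "W \<subseteq> T" "\<And>i. i \<in> I \<Longrightarrow> E i ` W \<subseteq> W"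
  shows "W = {0} \<or> W = T"
proof (rule ccontr)
  assume proper: "\<not> (W = {0} \<or> W = T)"
  have op: "weight_operator scale q (K i) (M i)" if "i \<in> I" for i
    using sl2[OF that] by (rule sl2_operators.axioms)
  have "\<exists>W'. subspace W' \<and> W' \<subseteq> T \<and> W' \<noteq> {0} \<and> W' \<noteq> T \<and> (\<forall>i\<in>I. E i ` W' \<subseteq> W') \<and> (\<forall>j\<in>J. K j ` W' \<subseteq> W')"
    if "finite J" "J \<subseteq> I" for J
    using that
  proof (induction J rule: finite_induct)
    case empty
    have "\<forall>i\<in>I. E i ` W \<subseteq> W" using W(3) by blast
    then show ?case using W(1,2) proper by (intro exI[of _ W]) simp
  next
    case (insert j J)
    then have j: "j \<in> I" and J: "J \<subseteq> I" by auto
    from insert.IH[OF J] obtain U where U: "subspace U" "U \<subseteq> T" "U \<noteq> {0}" "U \<noteq> T"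
        "\<forall>i\<in>I. E i ` U \<subseteq> U" "\<forall>i\<in>J. K i ` U \<subseteq> U"
      by (elim exE conjE)
    interpret j: sl2_operators scale q "K j" "M j" "E j" "F j" "d j" by (rule sl2[OF j])
    have "subspace (j.initial U)" by (rule j.subspace_initial[OF U(1)])
    moreover have "j.initial U \<subseteq> T" using j.initial_subset[OF T(1) T(4)[OF j] U(2)] .
    moreover have "j.initial U \<noteq> {0}" using j.initial_zero[OF U(1)] U(3) by blast
    moreover have "j.initial U \<noteq> T" using j.initial_full[OF T(1) _ U(1,2)] U(2,4) by blast
    moreover have "E i ` j.initial U \<subseteq> j.initial U" if i: "i \<in> I" for i
    proof -
      interpret i: sl2_operators scale q "K i" "M i" "E i" "F i" "d i" by (rule sl2[OF i])
      show ?thesis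
        by (rule j.initial_homogeneous[OF i.linear_E _ U(5)[rule_format, OF i], of "r j i"])
          (use KE[OF j i] in \<open>simp add: j.wt_def\<close>)
    qed
    moreover have "K i ` j.initial U \<subseteq> j.initial U" if i: "i \<in> J" for i
    proof -
      have iI: "i \<in> I" using i J by blast
      interpret i: sl2_operators scale q "K i" "M i" "E i" "F i" "d i" by (rule sl2[OF iI])
      show ?thesis
        by (rule j.initial_homogeneous[OF i.linear_K _ U(6)[rule_format, OF i], of 0])
          (use comm[OF j iI] in \<open>simp add: j.wt_def j.self.linear_scale[OF i.linear_K]\<close>)
    qed
    moreover have "K j ` j.initial U \<subseteq> j.initial U" by (rule j.initial_K_stable[OF U(1)])
    ultimately show ?case by blast
  qed
  from this[OF finite_I subset_refl] obtain U
    where U: "subspace U" "U \<subseteq> T" "U \<noteq> {0}" "U \<noteq> T"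
      "\<forall>i\<in>I. E i ` U \<subseteq> U" "\<forall>i\<in>I. K i ` U \<subseteq> U"
    by (elim exE conjE)
  let ?S = "{x \<in> U. \<forall>i\<in>I. \<exists>m. K i x = (q powi m) *s x}"
  \<comment> \<open>The basis of \<open>U\<close> is chosen among the joint weight vectors, so that
    one basis serves the dimension count for every \<open>i\<close>.\<close>
  obtain B where B: "B \<subseteq> ?S" "independent B" "?S \<subseteq> span B"
    using maximal_independent_subset by blast
  have "U \<subseteq> span ?S"
    using joint_weight_vectors_span[where K = K and M = M, OF op finite_I comm U(1) U(6)[rule_format]] by simp
  also have "span ?S \<subseteq> span B" using B(3) by (intro span_minimal subspace_span)
  finally have "U \<subseteq> span B" .
  moreover have "span B \<subseteq> U" using B(1) by (intro span_minimal U(1)) auto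
  ultimately have UB: "U = span B" by blast
  have "B \<subseteq> span S" using B(1) U(2) T(3) by blast
  then have finite_B: "finite B" using independent_span_bound[OF T(2) B(2)] by blast
  have "\<forall>b\<in>B. \<exists>lam. \<forall>i\<in>I. K i b = (q powi lam i) *s b"
    using B(1) by (auto intro: bchoice)
  then obtain lam where lam: "\<And>b i. b \<in> B \<Longrightarrow> i \<in> I \<Longrightarrow> K i b = (q powi lam b i) *s b"
    by metis
  \<comment> \<open>The determinant of \<open>K i\<close> on \<open>U\<close> is
    \<open>q powi tr i\<close>.\<close>
  define tr where "tr i = (\<Sum>b\<in>B. lam b i)" for i
  have tr_nonneg: "0 \<le> tr i" if i: "i \<in> I" for i
  proof -
    interpret i: sl2_operators scale q "K i" "M i" "E i" "F i" "d i" by (rule sl2[OF i])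
    show ?thesis unfolding tr_def
      using lam[OF _ i] by (intro i.sum_weights_nonneg[OF finite_B B(2) _ UB U(5)[rule_format, OF i]]) (simp add: i.wt_def)
  qed
  have "(\<Sum>i\<in>I. a i * tr i) = (\<Sum>b\<in>B. \<Sum>i\<in>I. a i * lam b i)"
    unfolding tr_def sum_distrib_left by (rule sum.swap)
  also have "\<dots> = 0"
  proof (rule sum.neutral, rule ballI)
    fix b assume b: "b \<in> B"
    then have "b \<noteq> 0" using B(2) dependent_zero by blast
    then show "(\<Sum>i\<in>I. a i * lam b i) = 0" using lam[OF b] by (rule level_zero)
  qed
  finally have "\<forall>i\<in>I. a i * tr i = 0"
    using sum_nonneg_eq_0_iff[OF finite_I, of "\<lambda>i. a i * tr i"] tr_nonneg a_pos
    by (simp add: order_less_imp_le)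
  then have tr: "tr i = 0" if "i \<in> I" for i
    using a_pos[OF that] that by auto
  have "F i ` U \<subseteq> U" if i: "i \<in> I" for i
  proof -
    interpret i: sl2_operators scale q "K i" "M i" "E i" "F i" "d i" by (rule sl2[OF i])
    have "\<And>b. b \<in> B \<Longrightarrow> b \<in> i.wt (lam b i)" using lam[OF _ i] by (simp add: i.wt_def)
    from i.E_pow_onto[OF finite_B B(2) this UB U(5)[rule_format, OF i]] show ?thesis
      using tr[OF i] unfolding tr_def by (intro i.F_stable U(1) U(5)[rule_format, OF i] U(6)[rule_format, OF i]) blast
  qed
  then have "U = {0} \<or> U = T" using U(1,2,5,6) by (intro irreducible) simp_all
  then show False using U(3,4) by blast
qed

end

subsection \<open>Matrices as operators on functions\<close>

text \<open>Functions on \<open>nat\<close> form one vector space as a type, whereas addition on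
  \<open>vec\<close> is meaningful only within one dimension.\<close>

definition fscale :: "'a::field \<Rightarrow> (nat \<Rightarrow> 'a) \<Rightarrow> nat \<Rightarrow> 'a" where
  "fscale c f = (\<lambda>i. c * f i)"

interpretation fun_space: vector_space fscale
  by unfold_locales (auto simp: fscale_def fun_eq_iff algebra_simps)

interpretation fun_space_pair: vector_space_pair fscale fscale
  by unfold_locales

definition embed :: "nat \<Rightarrow> 'a::field vec \<Rightarrow> nat \<Rightarrow> 'a" where
  "embed n v = (\<lambda>i. if i < n then v $ i else 0)"

text \<open>The coordinates outside \<open>{..<n}\<close> form a dummy summand, on which the operator is the
  scalar \<open>c\<close>; taking \<open>c = 1\<close> for the \<open>K\<^sub>i\<close> and \<open>c = 0\<close> for the \<open>E\<^sub>i\<close>, \<open>F\<^sub>i\<close> keeps all relations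
  valid on the whole function space, which avoids carrier sets.\<close>

definition lift_mat :: "nat \<Rightarrow> 'a::field \<Rightarrow> 'a mat \<Rightarrow> (nat \<Rightarrow> 'a) \<Rightarrow> nat \<Rightarrow> 'a" where
  "lift_mat n c A f = (\<lambda>i. if i < n then (A *\<^sub>v vec n f) $ i else c * f i)"

lemma vec_lift_mat: "A \<in> carrier_mat n n \<Longrightarrow> vec n (lift_mat n c A f) = A *\<^sub>v vec n f"
  by (intro eq_vecI) (auto simp: lift_mat_def)

lemma lift_mat_lift_mat:
  assumes "A \<in> carrier_mat n n" "B \<in> carrier_mat n n"
  shows "lift_mat n c A (lift_mat n c' B f) = lift_mat n (c * c') (A * B) f"
proof
  fix i
  have "A *\<^sub>v vec n (lift_mat n c' B f) = A * B *\<^sub>v vec n f"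
    using assms by (simp add: vec_lift_mat assoc_mult_mat_vec[of A n n B n])
  then show "lift_mat n c A (lift_mat n c' B f) i = lift_mat n (c * c') (A * B) f i"
    by (simp add: lift_mat_def mult.assoc)
qed

lemma lift_mat_diff:
  assumes "A \<in> carrier_mat n n" "B \<in> carrier_mat n n"
  shows "lift_mat n c A f - lift_mat n c' B f = lift_mat n (c - c') (A - B) f"
proof
  fix i
  have "(A - B) *\<^sub>v vec n f = A *\<^sub>v vec n f - B *\<^sub>v vec n f"
    using assms by (intro minus_mult_distrib_mat_vec) auto
  then show "(lift_mat n c A f - lift_mat n c' B f) i = lift_mat n (c - c') (A - B) f i"
    using assms by (simp add: lift_mat_def left_diff_distrib)
qed

lemma lift_mat_smult:
  assumes "A \<in> carrier_mat n n"
  shows "lift_mat n (k * c) (k \<cdot>\<^sub>m A) f = fscale k (lift_mat n c A f)"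
  using assms by (auto simp: lift_mat_def fscale_def fun_eq_iff mult.assoc)

lemma lift_mat_one: "lift_mat n 1 (1\<^sub>m n) f = f"
  by (auto simp: lift_mat_def fun_eq_iff)

lemma linear_lift_mat:
  assumes "A \<in> carrier_mat n n"
  shows "Vector_Spaces.linear fscale fscale (lift_mat n c A)"
proof -
  have "vec n (f + g) = vec n f + vec n g" for f g :: "nat \<Rightarrow> 'a" by (intro eq_vecI) auto
  then have add: "lift_mat n c A (f + g) = lift_mat n c A f + lift_mat n c A g" for f g
    using assms by (auto simp: lift_mat_def fun_eq_iff distrib_left mult_add_distrib_mat_vec[of A n n])
  have "vec n (fscale k f) = k \<cdot>\<^sub>v vec n f" for k and f :: "nat \<Rightarrow> 'a"
    by (intro eq_vecI) (auto simp: fscale_def)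
  then have "lift_mat n c A (fscale k f) = fscale k (lift_mat n c A f)" for k f
    using assms by (auto simp: lift_mat_def fun_eq_iff mult_mat_vec[of A n n])
      (auto simp: fscale_def)
  with add show ?thesis
    by (simp add: Vector_Spaces.linear_iff fun_space.vector_space_axioms)
qed

lemma embed_inj: "embed n v = embed n w \<Longrightarrow> v \<in> carrier_vec n \<Longrightarrow> w \<in> carrier_vec n \<Longrightarrow> v = w"
proof (rule eq_vecI)
  fix i assume "embed n v = embed n w" "w \<in> carrier_vec n" "i < dim_vec w"
  then show "v $ i = w $ i" by (auto simp: embed_def dest: fun_cong[of _ _ i])
qed simp

lemma embed_add:
  "v \<in> carrier_vec n \<Longrightarrow> w \<in> carrier_vec n \<Longrightarrow> embed n (v + w) = embed n v + embed n w"
  by (auto simp: embed_def fun_eq_iff)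

lemma embed_smult: "v \<in> carrier_vec n \<Longrightarrow> embed n (c \<cdot>\<^sub>v v) = fscale c (embed n v)"
  by (auto simp: embed_def fscale_def fun_eq_iff)

lemma embed_zero: "embed n (0\<^sub>v n) = 0"
  by (auto simp: embed_def fun_eq_iff)

lemma embed_mult_mat_vec:
  assumes "A \<in> carrier_mat n n" "v \<in> carrier_vec n"
  shows "lift_mat n c A (embed n v) = embed n (A *\<^sub>v v)"
proof -
  have "vec n (embed n v) = v" using assms(2) by (intro eq_vecI) (auto simp: embed_def)
  then show ?thesis by (auto simp: lift_mat_def embed_def fun_eq_iff)
qed

lemma embed_mult_mat_vec_eq_sum:
  assumes "P \<in> carrier_mat n n" "u \<in> carrier_vec n"
  shows "embed n (P *\<^sub>v u) = (\<Sum>k<n. fscale (u $ k) (embed n (col P k)))"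
proof
  fix i
  have sum_apply: "(\<Sum>k<n. g k) i = (\<Sum>k<n. g k i)" for g :: "nat \<Rightarrow> nat \<Rightarrow> 'a"
    by (induction n) auto
  show "embed n (P *\<^sub>v u) i = (\<Sum>k<n. fscale (u $ k) (embed n (col P k))) i"
    using assms by (auto simp: sum_apply embed_def fscale_def scalar_prod_def atLeast0LessThan mult.commute
        intro!: sum.cong)
qed

text \<open>In \<open>A = P * D * Q\<close> the columns of \<open>P\<close> are eigenvectors for the
  diagonal entries of \<open>D\<close>. The extra exponent 0 accounts for the coordinates from
  \<open>n\<close> on, where the lifted operator is the identity.\<close>

lemma lift_mat_span_weight_vectors:
  assumes "similar_mat A D" "diagonal_mat D" "A \<in> carrier_mat n n"
    and D: "\<And>k. k < n \<Longrightarrow> D $$ (k, k) = q powi \<mu> k"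
  shows "fun_space.span (\<Union>m\<in>insert 0 (\<mu> ` {..<n}). {x. lift_mat n 1 A x = fscale (q powi m) x}) = UNIV"
    (is "fun_space.span ?S = UNIV")
proof -
  obtain P Q where PQ: "{A, D, P, Q} \<subseteq> carrier_mat n n" "P * Q = 1\<^sub>m n" "Q * P = 1\<^sub>m n" "A = P * D * Q"
    using similar_matD[OF assms(1)] assms(3) by (metis (no_types, lifting) carrier_matD(1) carrier_matI insert_subset)
  then have dims: "D \<in> carrier_mat n n" "P \<in> carrier_mat n n" "Q \<in> carrier_mat n n" by auto
  have AP: "A * P = P * D"
  proof -
    have "A * P = P * D * (Q * P)"
      unfolding PQ(4) using dims by (intro assoc_mult_mat[of _ n n _ n _ n]) auto
    moreover have "P * D \<in> carrier_mat n n" using dims by (auto intro: mult_carrier_mat)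
    ultimately show ?thesis by (simp only: PQ(3) right_mult_one_mat)
  qed
  have col: "embed n (col P k) \<in> fun_space.span ?S" if k: "k < n" for k
  proof -
    have "col (P * D) k = (q powi \<mu> k) \<cdot>\<^sub>v col P k"
    proof (rule eq_vecI)
      fix i assume "i < dim_vec ((q powi \<mu> k) \<cdot>\<^sub>v col P k)"
      then have i: "i < n" using dims by auto
      have "(P * D) $$ (i, k) = (\<Sum>j\<in>{0..<n}. P $$ (i, j) * D $$ (j, k))"
        using dims i k by (simp add: scalar_prod_def)
      also have "\<dots> = (\<Sum>j\<in>{0..<n}. if j = k then P $$ (i, k) * D $$ (k, k) else 0)"
        using assms(2) dims k by (intro sum.cong) (auto simp: diagonal_mat_def)
      also have "\<dots> = P $$ (i, k) * D $$ (k, k)" using k by simp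
      finally show "col (P * D) k $ i = ((q powi \<mu> k) \<cdot>\<^sub>v col P k) $ i"
        using dims i k D[OF k] by (simp add: mult.commute)
    qed (use dims in simp)
    moreover have "col (A * P) k = A *\<^sub>v col P k"
      using dims assms(3) k by (intro col_mult2[of _ n n _ n]) auto
    ultimately have "A *\<^sub>v col P k = (q powi \<mu> k) \<cdot>\<^sub>v col P k" using AP by simp
    then have "lift_mat n 1 A (embed n (col P k)) = fscale (q powi \<mu> k) (embed n (col P k))"
      using dims k embed_mult_mat_vec[OF assms(3), of "col P k" 1] by (simp add: embed_smult)
    then show ?thesis using k by (intro fun_space.span_base) auto
  qed
  have "x \<in> fun_space.span ?S" for x
  proof -
    let ?y = "embed n (vec n x)"
    have "P *\<^sub>v (Q *\<^sub>v vec n x) = vec n x"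
      using PQ(2) dims assoc_mult_mat_vec[of P n n Q n "vec n x"] by simp
    then have "?y = (\<Sum>k<n. fscale ((Q *\<^sub>v vec n x) $ k) (embed n (col P k)))"
      using embed_mult_mat_vec_eq_sum[of P n "Q *\<^sub>v vec n x"] dims by (simp add: mult_mat_vec_carrier[of Q n n])
    then have y: "?y \<in> fun_space.span ?S"
      using col by (auto intro!: fun_space.span_sum fun_space.span_scale)
    have "vec n (x - ?y) = 0\<^sub>v n" by (intro eq_vecI) (auto simp: embed_def)
    then have "lift_mat n 1 A (x - ?y) = fscale (q powi 0) (x - ?y)"
      using assms(3) by (auto simp: lift_mat_def fscale_def fun_eq_iff embed_def)
    then have "x - ?y \<in> fun_space.span ?S" by (intro fun_space.span_base) blast
    from fun_space.span_add[OF this y] show ?thesis by simp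
  qed
  then show ?thesis by blast
qed

lemma mprod_carrier:
  "(\<And>i. i \<in> set xs \<Longrightarrow> f i \<in> carrier_mat n n) \<Longrightarrow> mprod n f xs \<in> carrier_mat n n"
  by (induction xs) (auto simp: mprod_def intro!: mult_carrier_mat[of _ n n])

lemma lift_mat_mprod_eigen:
  assumes "\<And>i. i \<in> set xs \<Longrightarrow> f i \<in> carrier_mat n n"
    and "\<And>i. i \<in> set xs \<Longrightarrow> lift_mat n 1 (f i) x = fscale (c i) x"
  shows "lift_mat n 1 (mprod n f xs) x = fscale (prod_list (map c xs)) x"
  using assms
proof (induction xs)
  case Nil
  then show ?case by (simp add: mprod_def lift_mat_one)
next
  case (Cons i xs)
  have "lift_mat n 1 (mprod n f (i # xs)) x = lift_mat n 1 (f i) (lift_mat n 1 (mprod n f xs) x)"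
    using lift_mat_lift_mat[of "f i" n "mprod n f xs" 1 1 x] mprod_carrier[of xs f n] Cons.prems
    by (simp add: mprod_def)
  also have "\<dots> = fscale (prod_list (map c xs)) (lift_mat n 1 (f i) x)"
    using Cons by (simp add: fun_space_pair.linear_scale[OF linear_lift_mat])
  finally show ?case using Cons.prems(2)[of i] by (simp add: mult.commute)
qed

lemma lift_mat_power_eigen:
  assumes "A \<in> carrier_mat n n" "lift_mat n 1 A x = fscale c x"
  shows "lift_mat n 1 (A ^\<^sub>m k) x = fscale (c ^ k) x"
proof (induction k)
  case 0
  then show ?case using assms(1) by (simp add: lift_mat_one)
next
  case (Suc k)
  have "lift_mat n 1 (A ^\<^sub>m Suc k) x = lift_mat n 1 (A ^\<^sub>m k) (lift_mat n 1 A x)"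
    using lift_mat_lift_mat[of "A ^\<^sub>m k" n A 1 1 x] assms(1) by simp
  then show ?case using assms Suc fun_space_pair.linear_scale[OF linear_lift_mat[of "A ^\<^sub>m k" n 1]]
    by (simp add: mult.commute)
qed

subsection \<open>The quantum loop algebra\<close>

lemma qq_nonzero: "qq \<noteq> 0"
  by (simp add: qq_def eq_fract Zero_fract_def)

text \<open>\<open>qq\<close> is the image of the indeterminate, so the equation descends to
  polynomials, where the left side has degree \<open>k\<close>.\<close>

lemma qq_power_eq_one: "qq ^ k = 1 \<Longrightarrow> k = 0"
proof -
  assume *: "qq ^ k = 1"
  have "Fract [:0, 1:] 1 ^ k = Fract (([:0, 1:] :: complex poly) ^ k) 1"
    by (induction k) (simp_all add: One_fract_def)
  then have "Fract (([:0, 1:] :: complex poly) ^ k) 1 = 1"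
    using * unfolding qq_def by (metis to_ac_eq_1_iff to_ac_power)
  then have "([:0, 1:] :: complex poly) ^ k = 1"
    by (simp add: One_fract_def eq_fract)
  then have "degree (([:0, 1:] :: complex poly) ^ k) = 0" by simp
  then show "k = 0" by (simp add: degree_power_eq)
qed

lemma qq_powi_eq_one: "qq powi k = 1 \<Longrightarrow> k = 0"
proof (cases "k \<ge> 0")
  case True
  moreover assume "qq powi k = 1"
  ultimately show ?thesis using qq_power_eq_one[of "nat k"] by (simp add: power_int_def)
next
  case False
  moreover assume "qq powi k = 1"
  ultimately show ?thesis using qq_power_eq_one[of "nat (- k)"]
    by (simp add: power_int_def power_inverse)
qed

text \<open>The highest root dominates the simple root at \<open>i\<close>, whose coefficient there
  is 1.\<close>

lemma highest_root_pos:
  assumes "highest_root A l \<theta>" "i \<in> {1..l}"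
  shows "\<theta> i \<ge> 1"
  using assms roots.simple[OF assms(2), of A] unfolding highest_root_def
  by (force simp: simple_root_def)

lemma mark_pos:
  assumes "highest_root A l \<theta>" "i \<in> {0..l}"
  shows "mark \<theta> i > 0"
  using highest_root_pos[OF assms(1), of i] assms(2) by (auto simp: mark_def)

lemma untwisted_affine_datum_diagonal:
  assumes "untwisted_affine_datum A d l \<theta>" "i \<in> {0..l}"
  shows "A i i = 2"
  using assms by (cases "i = 0") (auto simp: untwisted_affine_datum_def fin_type_cartan_def)

text \<open>For \<open>i = 0\<close>, the number \<open>2 * d 0\<close> is the value of the positive
  definite symmetrized form at the nonzero vector \<theta>.\<close>

lemma untwisted_affine_datum_symmetrizer_pos:
  assumes datum: "untwisted_affine_datum A d l \<theta>" and i: "i \<in> {0..l}"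
  shows "d i > 0"
proof (cases "i = 0")
  case False
  then show ?thesis using assms by (auto simp: untwisted_affine_datum_def fin_type_cartan_def)
next
  case True
  have l: "l \<ge> 1" and hr: "highest_root A l \<theta>"
    using datum by (auto simp: untwisted_affine_datum_def fin_type_cartan_def)
  have "\<exists>i\<in>{1..l}. real_of_int (\<theta> i) \<noteq> 0"
    using highest_root_pos[OF hr, of 1] l by (intro bexI[of _ 1]) auto
  then have "0 < (\<Sum>i\<in>{1..l}. \<Sum>j\<in>{1..l}. real_of_int (\<theta> i) * real (d i) * real_of_int (A i j) * real_of_int (\<theta> j))"
    using datum unfolding untwisted_affine_datum_def fin_type_cartan_def
    by (elim conjE) (drule spec[of _ "\<lambda>i. real_of_int (\<theta> i)"], blast)
  also have "\<dots> = real_of_int (\<Sum>i\<in>{1..l}. \<Sum>j\<in>{1..l}. \<theta> i * int (d i) * A i j * \<theta> j)"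
    by simp
  also have "\<dots> = real_of_int (2 * int (d 0))"
    using datum by (simp only: untwisted_affine_datum_def)
  finally show ?thesis using True by simp
qed


section \<open>Transfer of the matrix representation to operators on functions\<close>

theorem theorem6p9:
  fixes A :: "nat \<Rightarrow> nat \<Rightarrow> int" and d :: "nat \<Rightarrow> nat" and l :: nat
    and \<theta> :: "nat \<Rightarrow> int" and n :: nat
    and E Fm K Kinv :: "nat \<Rightarrow> F mat"
  assumes "untwisted_affine_datum A d l \<theta>"
    and "is_rep_UqLg A d l \<theta> n E Fm K Kinv"
    and "type_one l n K"
    and "irreducible_under n (E ` {0..l} \<union> Fm ` {0..l} \<union> K ` {0..l} \<union> Kinv ` {0..l})"
  shows "irreducible_under n (E ` {0..l})"
proof -
  note datum = assms(1) and irr = assms(4)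
  have carrier: "E i \<in> carrier_mat n n" "Fm i \<in> carrier_mat n n"
      "K i \<in> carrier_mat n n" "Kinv i \<in> carrier_mat n n" if "i \<in> {0..l}" for i
    using assms(2) that by (simp_all only: is_rep_UqLg_def)
  have Kinv: "K i * Kinv i = 1\<^sub>m n" "Kinv i * K i = 1\<^sub>m n" if "i \<in> {0..l}" for i
    using assms(2) that by (simp_all only: is_rep_UqLg_def)
  have KK: "K i * K j = K j * K i" if "i \<in> {0..l}" "j \<in> {0..l}" for i j
    using assms(2) that by (simp only: is_rep_UqLg_def)
  have KEK: "K i * E j * Kinv i = ((qq ^ d i) powi A i j) \<cdot>\<^sub>m E j" if "i \<in> {0..l}" "j \<in> {0..l}" for i j
    using assms(2) that by (simp only: is_rep_UqLg_def)
  have KFK: "K i * Fm j * Kinv i = ((qq ^ d i) powi (- A i j)) \<cdot>\<^sub>m Fm j" if "i \<in> {0..l}" "j \<in> {0..l}" for i j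
    using assms(2) that by (simp only: is_rep_UqLg_def)
  have EF: "E i * Fm i - Fm i * E i = (1 / (qq ^ d i - inverse (qq ^ d i))) \<cdot>\<^sub>m (K i - Kinv i)"
    if "i \<in> {0..l}" for i
    using assms(2) that by (simp only: is_rep_UqLg_def) auto
  have level: "mprod n (\<lambda>i. K i ^\<^sub>m mark \<theta> i) [0..<Suc l] = 1\<^sub>m n"
    using assms(2) by (simp only: is_rep_UqLg_def)
  have highest: "highest_root A l \<theta>" using datum by (simp only: untwisted_affine_datum_def)
  have n: "n > 0" using irr by (simp only: irreducible_under_def)

  define E' where "E' i = lift_mat n 0 (E i)" for i
  define F' where "F' i = lift_mat n 0 (Fm i)" for i
  define K' where "K' i = lift_mat n 1 (K i)" for i
  define L' where "L' i = lift_mat n 1 (Kinv i)" for i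
  note ops = E'_def F'_def K'_def L'_def

  have LK: "L' i (K' i x) = x" if "i \<in> {0..l}" for i x
    using that by (simp add: ops lift_mat_lift_mat carrier Kinv lift_mat_one)
  \<comment> \<open>Multiplying the conjugation relation by \<open>K i\<close> on the right removes
    the inverse. The exponent \<open>r\<close> is left open to serve both the raising and the
    lowering operators.\<close>
  have shift: "K' i (lift_mat n 0 Y x) = fscale (qq powi (m + int (d i) * r)) (lift_mat n 0 Y x)"
    if Y: "Y \<in> carrier_mat n n" "K i * Y * Kinv i = ((qq ^ d i) powi r) \<cdot>\<^sub>m Y" and i: "i \<in> {0..l}"
      and x: "K' i x = fscale (qq powi m) x" for i Y r m x
  proof -
    let ?s = "(qq ^ d i) powi r"
    have "K i * Y = K i * Y * (Kinv i * K i)"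
      using Y(1) carrier[OF i] Kinv[OF i] by (simp add: right_mult_one_mat[of _ n n] mult_carrier_mat[of _ n n])
    also have "\<dots> = K i * Y * Kinv i * K i"
      using Y(1) carrier[OF i] by (intro assoc_mult_mat[symmetric, of _ n n _ n _ n]) auto
    also have "\<dots> = ?s \<cdot>\<^sub>m (Y * K i)"
      unfolding Y(2) using Y(1) carrier[OF i] by (intro mult_smult_assoc_mat) auto
    finally have KX: "K i * Y = ?s \<cdot>\<^sub>m (Y * K i)" .
    \<comment> \<open>The zero on the dummy summand is written as \<open>?s * 0\<close> to fit
      \<open>lift_mat_smult\<close>.\<close>
    have "K' i (lift_mat n 0 Y x) = lift_mat n (?s * 0) (?s \<cdot>\<^sub>m (Y * K i)) x"
      using Y(1) carrier[OF i] by (simp add: ops lift_mat_lift_mat KX)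
    also have "\<dots> = fscale ?s (lift_mat n 0 (Y * K i) x)"
      using Y(1) carrier[OF i] by (intro lift_mat_smult mult_carrier_mat[of _ n n])
    also have "lift_mat n 0 (Y * K i) x = lift_mat n 0 Y (K' i x)"
      using Y(1) carrier[OF i] by (simp add: ops lift_mat_lift_mat)
    also have "\<dots> = fscale (qq powi m) (lift_mat n 0 Y x)"
      unfolding x by (rule fun_space_pair.linear_scale[OF linear_lift_mat[OF Y(1)]])
    also have "fscale ?s \<dots> = fscale (?s * qq powi m) (lift_mat n 0 Y x)" by simp
    also have "?s * qq powi m = qq powi (m + int (d i) * r)"
    proof -
      have "?s = qq powi (int (d i) * r)" by (simp only: power_int_mult power_int_of_nat)
      then show ?thesis using qq_nonzero by (simp add: power_int_add mult.commute)
    qed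
    finally show ?thesis .
  qed

  have "\<forall>i\<in>{0..l}. \<exists>M. finite M \<and> fun_space.span (\<Union>m\<in>M. {x. K' i x = fscale (qq powi m) x}) = UNIV"
  proof
    fix i assume i: "i \<in> {0..l}"
    obtain D where D: "similar_mat (K i) D" "diagonal_mat D" "\<forall>k<n. \<exists>m::int. D $$ (k, k) = qq powi m"
      using assms(3) i unfolding type_one_def by blast
    then obtain \<mu> where \<mu>: "\<And>k. k < n \<Longrightarrow> D $$ (k, k) = qq powi \<mu> k" by metis
    show "\<exists>M. finite M \<and> fun_space.span (\<Union>m\<in>M. {x. K' i x = fscale (qq powi m) x}) = UNIV"
      using lift_mat_span_weight_vectors[OF D(1,2) carrier(3)[OF i] \<mu>]
      by (intro exI[of _ "insert 0 (\<mu> ` {..<n})"]) (simp add: K'_def)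
  qed
  from bchoice[OF this] obtain M where M: "\<forall>i\<in>{0..l}. finite (M i) \<and>
      fun_space.span (\<Union>m\<in>M i. {x. K' i x = fscale (qq powi m) x}) = UNIV"
    by (rule exE)
  have op: "weight_operator fscale qq (K' i) (M i)" if i: "i \<in> {0..l}" for i
  proof (rule weight_operator.intro[OF fun_space.vector_space_axioms weight_operator_axioms.intro])
    show "Vector_Spaces.linear fscale fscale (K' i)"
      unfolding K'_def by (rule linear_lift_mat[OF carrier(3)[OF i]])
    show "qq \<noteq> 0" by (rule qq_nonzero)
    show "qq powi k = 1 \<Longrightarrow> k = 0" for k by (rule qq_powi_eq_one)
    show "finite (M i)" using M i by blast
    show "fun_space.span (\<Union>m\<in>M i. {x. K' i x = fscale (qq powi m) x}) = UNIV"
      using M i by blast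
  qed
  have sl2: "sl2_operators fscale qq (K' i) (M i) (E' i) (F' i) (d i)" if i: "i \<in> {0..l}" for i
  proof -
    interpret weight_operator fscale qq "K' i" "M i" by (rule op[OF i])
    have Aii: "A i i = 2" by (rule untwisted_affine_datum_diagonal[OF datum i])
    show ?thesis
    proof (rule sl2_operators.intro[OF op[OF i] sl2_operators_axioms.intro])
      show "d i > 0" by (rule untwisted_affine_datum_symmetrizer_pos[OF datum i])
      show "Vector_Spaces.linear fscale fscale (E' i)" "Vector_Spaces.linear fscale fscale (F' i)"
        unfolding ops by (rule linear_lift_mat, rule carrier[OF i])+
      fix x m assume x: "x \<in> wt m"
      show "E' i x \<in> wt (m + 2 * int (d i))"
        using shift[OF carrier(1)[OF i] KEK[OF i i] i, of x m] x
        by (simp add: wt_def E'_def Aii mult.commute)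
      show "F' i x \<in> wt (m - 2 * int (d i))"
        using shift[OF carrier(2)[OF i] KFK[OF i i] i, of x m] x
        by (simp add: wt_def F'_def Aii mult.commute)
      let ?e = "qq ^ d i - inverse (qq ^ d i)"
      have Kx: "K' i x = fscale (qq powi m) x" using x by (simp add: wt_def)
      have Lx: "L' i x = fscale (qq powi (- m)) x"
      proof -
        have "x = L' i (K' i x)" using LK[OF i] by simp
        also have "\<dots> = fscale (qq powi m) (L' i x)"
          unfolding Kx L'_def by (rule fun_space_pair.linear_scale[OF linear_lift_mat[OF carrier(4)[OF i]]])
        finally have "fscale (qq powi (- m)) x = fscale (qq powi (- m) * qq powi m) (L' i x)"
          by (metis fun_space.scale_scale)
        then show ?thesis using qq_nonzero by (simp add: power_int_minus)
      qed
      have "E' i (F' i x) - F' i (E' i x) = lift_mat n (1 / ?e * 0) ((1 / ?e) \<cdot>\<^sub>m (K i - Kinv i)) x"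
        using carrier[OF i] by (simp add: ops lift_mat_lift_mat lift_mat_diff EF[OF i] mult_carrier_mat[of _ n n])
      also have "\<dots> = fscale (1 / ?e) (lift_mat n (1 - 1) (K i - Kinv i) x)"
        using carrier[OF i] by (subst lift_mat_smult) auto
      also have "lift_mat n (1 - 1) (K i - Kinv i) x = K' i x - L' i x"
        unfolding ops using carrier[OF i] by (subst lift_mat_diff) auto
      also have "\<dots> = fscale (qq powi m - qq powi (- m)) x"
        unfolding Kx Lx by (rule fun_space.scale_left_diff_distrib[symmetric])
      also have "fscale (1 / ?e) \<dots> = fscale ((qq powi m - qq powi (- m)) / ?e) x" by simp
      finally show "E' i (F' i x) - F' i (E' i x) = fscale ((qq powi m - qq powi (- m)) / ?e) x" .
    qed
  qed

  \<comment> \<open>The lifted operators act on all functions; \<open>?T\<close> is the copy of the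
    original module.\<close>
  let ?T = "{f :: nat \<Rightarrow> F. \<forall>i\<ge>n. f i = 0}"
  have T: "fun_space.subspace ?T"
    by (auto simp: fun_space.subspace_def fscale_def)
  have embed_T: "embed n v \<in> ?T" for v :: "F vec" by (simp add: embed_def)
  have embed_vec: "embed n (vec n f) = f" if "f \<in> ?T" for f :: "nat \<Rightarrow> F"
    using that by (auto simp: embed_def fun_eq_iff)
  have T_span: "?T \<subseteq> fun_space.span ((\<lambda>k. embed n (unit_vec n k)) ` {..<n})"
  proof
    fix f assume f: "f \<in> ?T"
    have "f = embed n (1\<^sub>m n *\<^sub>v vec n f)" using embed_vec[OF f] by simp
    also have "\<dots> = (\<Sum>k<n. fscale (vec n f $ k) (embed n (col (1\<^sub>m n) k)))"
      by (rule embed_mult_mat_vec_eq_sum) auto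
    also have "\<dots> = (\<Sum>k<n. fscale (vec n f $ k) (embed n (unit_vec n k)))"
      by (intro sum.cong) auto
    also have "\<dots> \<in> fun_space.span ((\<lambda>k. embed n (unit_vec n k)) ` {..<n})"
      by (intro fun_space.span_sum fun_space.span_scale fun_space.span_base) auto
    finally show "f \<in> fun_space.span ((\<lambda>k. embed n (unit_vec n k)) ` {..<n})" .
  qed

  have irreducible: "U = {0} \<or> U = ?T"
    if U: "fun_space.subspace U" "U \<subseteq> ?T"
      and stable: "\<And>i. i \<in> {0..l} \<Longrightarrow> E' i ` U \<subseteq> U \<and> F' i ` U \<subseteq> U \<and> K' i ` U \<subseteq> U" for U
  proof -
    \<comment> \<open>The given irreducibility also asks for stability under \<open>Kinv i\<close>,
      which follows from that under \<open>K i\<close>.\<close>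
    have stableL: "L' i ` U \<subseteq> U" if i: "i \<in> {0..l}" for i
    proof (rule weight_operator.inverse_stable[OF op[OF i] _ LK[OF i] U(1)])
      show "Vector_Spaces.linear fscale fscale (L' i)"
        unfolding L'_def by (rule linear_lift_mat[OF carrier(4)[OF i]])
      show "K' i ` U \<subseteq> U" using stable[OF i] by blast
    qed
    define W where "W = {v \<in> carrier_vec n. embed n v \<in> U}"
    have "subspace_vec n W"
      using fun_space.subspace_0[OF U(1)] fun_space.subspace_add[OF U(1)] fun_space.subspace_scale[OF U(1)]
      by (auto simp: subspace_vec_def W_def embed_add embed_smult embed_zero)
    moreover have lift_stable: "Y *\<^sub>v w \<in> W"
      if "Y \<in> carrier_mat n n" "lift_mat n c Y ` U \<subseteq> U" "w \<in> W" for Y c w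
      using that embed_mult_mat_vec[of Y n w c] mult_mat_vec_carrier[of Y n n w]
      by (auto simp: W_def)
    have "E i *\<^sub>v w \<in> W \<and> Fm i *\<^sub>v w \<in> W \<and> K i *\<^sub>v w \<in> W \<and> Kinv i *\<^sub>v w \<in> W"
      if i: "i \<in> {0..l}" and w: "w \<in> W" for i w
      using lift_stable[OF carrier(1)[OF i] _ w, of 0] lift_stable[OF carrier(2)[OF i] _ w, of 0]
        lift_stable[OF carrier(3)[OF i] _ w, of 1] lift_stable[OF carrier(4)[OF i] _ w, of 1]
        stable[OF i] stableL[OF i]
      unfolding ops by simp
    then have "\<forall>Y\<in>E ` {0..l} \<union> Fm ` {0..l} \<union> K ` {0..l} \<union> Kinv ` {0..l}. \<forall>w\<in>W. Y *\<^sub>v w \<in> W"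
      by blast
    ultimately have W: "W = {0\<^sub>v n} \<or> W = carrier_vec n"
      using irr unfolding irreducible_under_def by blast
    have UW: "U = embed n ` W"
    proof (intro equalityI subsetI)
      fix f assume f: "f \<in> U"
      then have eq: "embed n (vec n f) = f" using U(2) by (intro embed_vec) auto
      then have "vec n f \<in> W" using f by (simp add: W_def)
      then show "f \<in> embed n ` W" using eq by (rule image_eqI[OF sym, rotated])
    qed (auto simp: W_def)
    have T_image: "embed n ` carrier_vec n = ?T"
    proof (intro equalityI subsetI)
      fix f assume "f \<in> ?T"
      from embed_vec[OF this] show "f \<in> embed n ` carrier_vec n"
        by (intro image_eqI[of _ _ "vec n f"]) auto
    qed (use embed_T in blast)
    from W show ?thesis
    proof
      assume "W = {0\<^sub>v n}"
      then have "U = {0}" unfolding UW by (simp only: image_insert image_empty embed_zero)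
      then show ?thesis by (rule disjI1)
    next
      assume "W = carrier_vec n"
      then have "U = ?T" using UW T_image by (simp only:)
      then show ?thesis by (rule disjI2)
    qed
  qed

  \<comment> \<open>On a joint weight vector the product relation says that a power of
    \<open>qq\<close> equals 1; its exponent is the sum in question and must vanish.\<close>
  have level_zero: "(\<Sum>i\<in>{0..l}. int (mark \<theta> i) * lam i) = 0"
    if x: "x \<noteq> 0" "\<And>i. i \<in> {0..l} \<Longrightarrow> K' i x = fscale (qq powi lam i) x" for x lam
  proof -
    let ?c = "\<lambda>i. (qq powi lam i) ^ mark \<theta> i"
    have eigen: "lift_mat n 1 (mprod n (\<lambda>i. K i ^\<^sub>m mark \<theta> i) [0..<Suc l]) x =
        fscale (prod_list (map ?c [0..<Suc l])) x"
    proof (rule lift_mat_mprod_eigen)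
      fix i assume "i \<in> set [0..<Suc l]"
      then have i: "i \<in> {0..l}" by auto
      show "K i ^\<^sub>m mark \<theta> i \<in> carrier_mat n n" using carrier(3)[OF i] by simp
      show "lift_mat n 1 (K i ^\<^sub>m mark \<theta> i) x = fscale (?c i) x"
        using x(2)[OF i] unfolding K'_def by (rule lift_mat_power_eigen[OF carrier(3)[OF i]])
    qed
    have "fscale (prod_list (map ?c [0..<Suc l])) x = fscale 1 x"
      unfolding eigen[symmetric] level lift_mat_one by (rule fun_space.scale_one[symmetric])
    then have "prod_list (map ?c [0..<Suc l]) = 1"
      using x(1) by (simp only: fun_space.scale_cancel_right) simp
    moreover have "prod_list (map ?c xs) = qq powi (\<Sum>i\<leftarrow>xs. int (mark \<theta> i) * lam i)" for xs
    proof (induction xs)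
      case (Cons i xs)
      have "?c i = qq powi (int (mark \<theta> i) * lam i)"
        by (simp only: mult.commute[of "int (mark \<theta> i)"] power_int_mult power_int_of_nat)
      with Cons show ?case using qq_nonzero by (simp add: power_int_add)
    qed simp
    ultimately have "(\<Sum>i\<leftarrow>[0..<Suc l]. int (mark \<theta> i) * lam i) = 0"
      using qq_powi_eq_one by metis
    then show ?thesis
      by (simp add: interv_sum_list_conv_sum_set_nat atLeastLessThanSuc_atLeastAtMost del: upt_Suc)
  qed

  show ?thesis
    unfolding irreducible_under_def
  proof (intro conjI allI impI n)
    fix W assume W: "subspace_vec n W \<and> (\<forall>M\<in>E ` {0..l}. \<forall>w\<in>W. M *\<^sub>v w \<in> W)"
    then have W_sub: "subspace_vec n W" and W_carrier: "W \<subseteq> carrier_vec n"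
      by (auto simp: subspace_vec_def)
    have sub: "fun_space.subspace (embed n ` W)"
    proof (rule fun_space.subspaceI)
      show "0 \<in> embed n ` W"
        using W_sub embed_zero unfolding subspace_vec_def by (metis image_eqI)
      show "x + y \<in> embed n ` W" if "x \<in> embed n ` W" "y \<in> embed n ` W" for x y
        using that W_sub W_carrier embed_add unfolding subspace_vec_def
        by (smt (verit) image_iff subsetD)
      show "fscale c x \<in> embed n ` W" if "x \<in> embed n ` W" for c x
        using that W_sub W_carrier embed_smult unfolding subspace_vec_def
        by (smt (verit) image_iff subsetD)
    qed
    have WT: "embed n ` W \<subseteq> ?T" using embed_T by blast
    have EW: "E' i ` embed n ` W \<subseteq> embed n ` W" if i: "i \<in> {0..l}" for i
    proof -
      have "E' i (embed n w) = embed n (E i *\<^sub>v w)" if "w \<in> W" for w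
        unfolding E'_def using carrier(1)[OF i] that W_carrier by (intro embed_mult_mat_vec) auto
      moreover have "E i *\<^sub>v w \<in> W" if "w \<in> W" for w using W i that by blast
      ultimately show ?thesis by auto
    qed
    have "embed n ` W = {0} \<or> embed n ` W = ?T"
    proof (rule fun_space.raising_operators_irreducible[where I = "{0..l}" and q = qq and K = K' and M = M
          and E = E' and F = F' and d = d and r = "\<lambda>i j. int (d i) * A i j" and a = "\<lambda>i. int (mark \<theta> i)"
          and S = "(\<lambda>k. embed n (unit_vec n k)) ` {..<n}" and T = ?T and W = "embed n ` W",
          OF sl2 _ _ _ _ level_zero T _ T_span _ irreducible sub WT EW])
      show "K' i (K' j x) = K' j (K' i x)" if "i \<in> {0..l}" "j \<in> {0..l}" for i j x
        using that by (simp add: K'_def lift_mat_lift_mat carrier KK[of i j])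
      show "K' i (E' j x) = fscale (qq powi (m + int (d i) * A i j)) (E' j x)"
        if "i \<in> {0..l}" "j \<in> {0..l}" "K' i x = fscale (qq powi m) x" for i j m x
        unfolding E'_def using that by (intro shift carrier KEK)
      show "0 < int (mark \<theta> i)" if "i \<in> {0..l}" for i
        using mark_pos[OF highest that] by simp
      show "K' i ` ?T \<subseteq> ?T" for i by (auto simp: K'_def lift_mat_def)
    qed simp_all
    then show "W = {0\<^sub>v n} \<or> W = carrier_vec n"
    proof
      assume 0: "embed n ` W = {0}"
      have "w = 0\<^sub>v n" if "w \<in> W" for w
      proof (rule embed_inj)
        show "embed n w = embed n (0\<^sub>v n)" using 0 that by (auto simp: embed_zero)
      qed (use that W_carrier in auto)
      then show ?thesis using W_sub unfolding subspace_vec_def by blast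
    next
      assume T: "embed n ` W = ?T"
      have "v \<in> W" if v: "v \<in> carrier_vec n" for v
      proof -
        obtain w where "w \<in> W" "embed n v = embed n w" using T embed_T[of v] by blast
        then show ?thesis using embed_inj[of n v w] v W_carrier by auto
      qed
      then show ?thesis using W_carrier by blast
    qed
  qed
qed

end
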